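(* Let $(\mathfrak{X},\Gamma,\Phi)$ be a nilpotent Cantor action. If the prime spectrum $\pi[\mathfrak{X},\Gamma,\Phi]$ is a finite set, then the action is stable.
   Context: A Cantor action $(\mathfrak{X},\Gamma,\Phi)$ is an action $\Phi\colon\Gamma\times\mathfrak{X}\to\mathfrak{X}$ of a countable group $\Gamma$ by homeomorphisms of a Cantor space $\mathfrak{X}$ which is minimal (every orbit is dense) and equicontinuous. It is a nilpotent Cantor action if $\Gamma$ contains a finitely generated nilpotent subgroup of finite index. A nonempty clopen $U\subset\mathfrak{X}$ is adapted if for all $g\in\Gamma$, $\Phi(g)(U)\cap U\neq\emptyset$ implies $\Phi(g)(U)=U$; its stabilizer $\Gamma_U=\{g:\Phi(g)(U)=U\}$ then has finite index in $\Gamma$. An adapted neighborhood basis at $x\in\mathfrak{X}$ is a properly decreasing sequence $U_1\supset U_2\supset\cdots$ of adapted clopen sets with $\bigcap_\ell U_\ell=\{x\}$ (such always exists). The Steinitz order of the action is the supernatural number $\xi(\mathfrak{X},\Gamma,\Phi)=\mathrm{lcm}\{[\Gamma:\Gamma_{U_\ell}]:\ell\ge1\}=\prod_p p^{\chi(p)}$ with $\chi(p)\in\{0,1,\dots,\infty\}$ (it does not depend on the choices made). The prime spectrum is $\pi[\mathfrak{X},\Gamma,\Phi]=\{p \text{ prime}:\chi(p)>0\}$. An action of a group $G$ (discrete or profinite) by homeomorphisms on a metric Cantor space $\mathfrak{X}$ is locally quasi-analytic if there is $\varepsilon>0$ such that for every nonempty open $U$ with $\mathrm{diam}(U)<\varepsilon$,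 every nonempty open $V\subset U$, and all $g_1,g_2\in G$: if $g_1|_V=g_2|_V$ then $g_1|_U=g_2|_U$. Let $\mathfrak{G}(\Phi)$ be the closure of $\Phi(\Gamma)$ in $\mathrm{Homeo}(\mathfrak{X})$ in the uniform topology (a profinite group acting on $\mathfrak{X}$). The action $(\mathfrak{X},\Gamma,\Phi)$ is stable if the action of $\mathfrak{G}(\Phi)$ on $\mathfrak{X}$ is locally quasi-analytic, and wild otherwise. *)

theory Defs
  imports "HOL-Analysis.Analysis" "HOL-Algebra.Algebra"
begin

fun lower_central :: "('g, 'b) monoid_scheme \<Rightarrow> 'g set \<Rightarrow> nat \<Rightarrow> 'g set" where
  "lower_central G H 0 = H"
| "lower_central G H (Suc n) =
     generate G {a \<otimes>\<^bsub>G\<^esub> b \<otimes>\<^bsub>G\<^esub> inv\<^bsub>G\<^esub> a \<otimes>\<^bsub>G\<^esub> inv\<^bsub>G\<^esub> b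
                 | a b. a \<in> lower_central G H n \<and> b \<in> H}"

definition nilpotent_subgroup :: "('g, 'b) monoid_scheme \<Rightarrow> 'g set \<Rightarrow> bool" where
  "nilpotent_subgroup G H \<longleftrightarrow> subgroup H G \<and> (\<exists>n. lower_central G H n = {\<one>\<^bsub>G\<^esub>})"

definition finitely_generated_subgroup :: "('g, 'b) monoid_scheme \<Rightarrow> 'g set \<Rightarrow> bool" where
  "finitely_generated_subgroup G H \<longleftrightarrow>
     subgroup H G \<and> (\<exists>S. finite S \<and> S \<subseteq> carrier G \<and> generate G S = H)"

definition group_index :: "('g, 'b) monoid_scheme \<Rightarrow> 'g set \<Rightarrow> nat" where
  "group_index G H = card (rcosets\<^bsub>G\<^esub> H)"

definition virtually_nilpotent :: "('g, 'b) monoid_scheme \<Rightarrow> bool" where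
  "virtually_nilpotent G \<longleftrightarrow>
     (\<exists>H. finitely_generated_subgroup G H \<and> nilpotent_subgroup G H
          \<and> finite (rcosets\<^bsub>G\<^esub> H))"

text \<open>The Cantor space is the whole (metric) type: compact, perfect, totally disconnected
  (nonemptiness is automatic for HOL types).\<close>
definition cantor_space :: "'a::metric_space itself \<Rightarrow> bool" where
  "cantor_space _ \<longleftrightarrow> compact (UNIV :: 'a set)
      \<and> (\<forall>x::'a. x islimpt UNIV)
      \<and> (\<forall>x::'a. connected_component_set UNIV x = {x})"

definition homeo_action :: "('g, 'b) monoid_scheme \<Rightarrow> ('g \<Rightarrow> 'a::metric_space \<Rightarrow> 'a) \<Rightarrow> bool" where
  "homeo_action G \<Phi> \<longleftrightarrow> group G
     \<and> (\<forall>g\<in>carrier G. \<exists>h. homeomorphism UNIV UNIV (\<Phi> g) h)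
     \<and> \<Phi> \<one>\<^bsub>G\<^esub> = id
     \<and> (\<forall>g\<in>carrier G. \<forall>h\<in>carrier G. \<Phi> (g \<otimes>\<^bsub>G\<^esub> h) = \<Phi> g \<circ> \<Phi> h)"

definition minimal_action :: "('g, 'b) monoid_scheme \<Rightarrow> ('g \<Rightarrow> 'a::metric_space \<Rightarrow> 'a) \<Rightarrow> bool" where
  "minimal_action G \<Phi> \<longleftrightarrow> (\<forall>x. closure ((\<lambda>g. \<Phi> g x) ` carrier G) = UNIV)"

definition equicontinuous_action :: "('g, 'b) monoid_scheme \<Rightarrow> ('g \<Rightarrow> 'a::metric_space \<Rightarrow> 'a) \<Rightarrow> bool" where
  "equicontinuous_action G \<Phi> \<longleftrightarrow>
     (\<forall>e>0. \<exists>d>0. \<forall>g\<in>carrier G. \<forall>x y. dist x y < d \<longrightarrow> dist (\<Phi> g x) (\<Phi> g y) < e)"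

definition cantor_action :: "('g, 'b) monoid_scheme \<Rightarrow> ('g \<Rightarrow> 'a::metric_space \<Rightarrow> 'a) \<Rightarrow> bool" where
  "cantor_action G \<Phi> \<longleftrightarrow> cantor_space TYPE('a) \<and> countable (carrier G)
     \<and> homeo_action G \<Phi> \<and> minimal_action G \<Phi> \<and> equicontinuous_action G \<Phi>"

definition nilpotent_cantor_action :: "('g, 'b) monoid_scheme \<Rightarrow> ('g \<Rightarrow> 'a::metric_space \<Rightarrow> 'a) \<Rightarrow> bool" where
  "nilpotent_cantor_action G \<Phi> \<longleftrightarrow> cantor_action G \<Phi> \<and> virtually_nilpotent G"

definition clopen_set :: "'a::topological_space set \<Rightarrow> bool" where
  "clopen_set U \<longleftrightarrow> open U \<and> closed U"

definition adapted :: "('g, 'b) monoid_scheme \<Rightarrow> ('g \<Rightarrow> 'a::metric_space \<Rightarrow> 'a) \<Rightarrow> 'a set \<Rightarrow> bool" where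
  "adapted G \<Phi> U \<longleftrightarrow> U \<noteq> {} \<and> clopen_set U
     \<and> (\<forall>g\<in>carrier G. \<Phi> g ` U \<inter> U \<noteq> {} \<longrightarrow> \<Phi> g ` U = U)"

definition stabilizer_set :: "('g, 'b) monoid_scheme \<Rightarrow> ('g \<Rightarrow> 'a \<Rightarrow> 'a) \<Rightarrow> 'a set \<Rightarrow> 'g set" where
  "stabilizer_set G \<Phi> U = {g \<in> carrier G. \<Phi> g ` U = U}"

definition adapted_basis ::
  "('g, 'b) monoid_scheme \<Rightarrow> ('g \<Rightarrow> 'a::metric_space \<Rightarrow> 'a) \<Rightarrow> 'a \<Rightarrow> (nat \<Rightarrow> 'a set) \<Rightarrow> bool" where
  "adapted_basis G \<Phi> x U \<longleftrightarrow> (\<forall>l. adapted G \<Phi> (U l)) \<and> (\<forall>l. U (Suc l) \<subset> U l)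
     \<and> (\<Inter>l. U l) = {x}"

text \<open>Exponent chi(p) of p in the Steinitz order lcm{[G : G_{U_l}]}, as an extended natural.\<close>
definition steinitz_exponent ::
  "('g, 'b) monoid_scheme \<Rightarrow> ('g \<Rightarrow> 'a \<Rightarrow> 'a) \<Rightarrow> (nat \<Rightarrow> 'a set) \<Rightarrow> nat \<Rightarrow> enat" where
  "steinitz_exponent G \<Phi> U p =
     (SUP l. enat (Factorial_Ring.multiplicity p (group_index G (stabilizer_set G \<Phi> (U l)))))"

text \<open>Prime spectrum: primes with chi(p) > 0, computed with respect to a chosen adapted basis
  (the paper shows this is independent of the choices).\<close>
definition prime_spectrum ::
  "('g, 'b) monoid_scheme \<Rightarrow> ('g \<Rightarrow> 'a \<Rightarrow> 'a) \<Rightarrow> (nat \<Rightarrow> 'a set) \<Rightarrow> nat set" where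
  "prime_spectrum G \<Phi> U = {p. Factorial_Ring.prime p \<and> steinitz_exponent G \<Phi> U p > 0}"

definition ellis_closure :: "('g, 'b) monoid_scheme \<Rightarrow> ('g \<Rightarrow> 'a::metric_space \<Rightarrow> 'a) \<Rightarrow> ('a \<Rightarrow> 'a) set" where
  "ellis_closure G \<Phi> = {f. (\<exists>h. homeomorphism UNIV UNIV f h)
       \<and> (\<forall>e>0. \<exists>g\<in>carrier G. \<forall>x. dist (f x) (\<Phi> g x) < e)}"

definition locally_quasi_analytic :: "('a::metric_space \<Rightarrow> 'a) set \<Rightarrow> bool" where
  "locally_quasi_analytic H \<longleftrightarrow> (\<exists>e>0. \<forall>U V. open U \<and> U \<noteq> {} \<and> diameter U < e
       \<and> open V \<and> V \<noteq> {} \<and> V \<subseteq> U \<longrightarrow>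
       (\<forall>g1\<in>H. \<forall>g2\<in>H. (\<forall>y\<in>V. g1 y = g2 y) \<longrightarrow> (\<forall>y\<in>U. g1 y = g2 y)))"

definition stable_action :: "('g, 'b) monoid_scheme \<Rightarrow> ('g \<Rightarrow> 'a::metric_space \<Rightarrow> 'a) \<Rightarrow> bool" where
  "stable_action G \<Phi> \<longleftrightarrow> locally_quasi_analytic (ellis_closure G \<Phi>)"

end

theory Submission
  imports Defs
begin

text \<open>The pointwise stabilizers of the sets \<open>U l\<close> in the Ellis group form an increasing chain; the
  point is that this chain is eventually constant. Conjugating by \<open>G\<close> and using minimality, an
  element of the Ellis group that is trivial near some point is then trivial on the whole translate
  of a fixed \<open>U m\<close> containing that point, and a Lebesgue number for the cover by these translates
  gives local quasi-analyticity.

  The chain is studied in the finite quotients of \<open>G\<close> acting on the translates of \<open>U j\<close>. Let \<open>H\<close>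
  be a finitely generated nilpotent subgroup of finite index \<open>d\<close>. Subgroups of nilpotent groups are
  subnormal, so every \<open>h \<in> H\<close> has in these quotients an order whose prime factors lie in the prime
  spectrum or divide \<open>d!\<close>, hence divide one fixed \<open>P\<close>. By a Frattini argument a subgroup is
  determined by its image modulo \<open>P\<close>-th powers and commutators. As \<open>H\<close> has a central series with
  cyclic quotients, these images have bounded order, so one \<open>l\<close> serves for all levels \<open>j\<close>.\<close>

section \<open>Central series with cyclic quotients\<close>

text \<open>The obstacle is that the union of an increasing chain of closed subgroups of a profinite
  group need not be closed, so generators of the union cannot be sought in the Ellis group itself.
  At a finite level \<open>j\<close> the union causes no trouble, but the index at which the chain
  stops might grow with \<open>j\<close>. The whole proof is arranged to bound it uniformly.

  Two numbers that do not see \<open>j\<close> give this bound: the length \<open>k\<close> of a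
  central series of \<open>H\<close> with cyclic factors, which every subgroup of \<open>H\<close>
  inherits, and the integer \<open>P\<close>. For every subgroup \<open>B\<close> of
  \<open>H\<close> the group \<open>B / B^P [B, B]\<close> has at most \<open>P ^ k\<close>
  elements. With infinitely many primes in the spectrum \<open>P\<close> would have to change with
  \<open>j\<close>, and the chain could grow at ever new primes.

  In the series below, \<open>L' / L\<close> is cyclic, generated by the class of \<open>a\<close>,
  and central in \<open>H / L\<close>; stating this by elements and commutators avoids iterated
  quotient groups.\<close>

inductive central_series :: "('g, 'b) monoid_scheme \<Rightarrow> 'g set \<Rightarrow> nat \<Rightarrow> 'g set \<Rightarrow> bool"
  for G (structure) and H where
  trivial: "central_series G H 0 {\<one>}"
| step: "central_series G H k L \<Longrightarrow> subgroup L' G \<Longrightarrow> L \<subseteq> L' \<Longrightarrow> L' \<subseteq> H \<Longrightarrow> a \<in> L'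
    \<Longrightarrow> (\<And>g. g \<in> L' \<Longrightarrow> \<exists>t::int. \<exists>l\<in>L. g = a [^] t \<otimes> l)
    \<Longrightarrow> (\<And>g h. g \<in> L' \<Longrightarrow> h \<in> H \<Longrightarrow> g \<otimes> h \<otimes> inv g \<otimes> inv h \<in> L)
    \<Longrightarrow> central_series G H (Suc k) L'"

text \<open>The set \<open>L\<close> need not lie in \<open>H\<close>, and \<open>H\<close> may be a
  single element. For a subgroup \<open>H\<close> the inclusion is an equality, by conjugating with
  inverses.\<close>

definition normalizes :: "('g, 'b) monoid_scheme \<Rightarrow> 'g set \<Rightarrow> 'g set \<Rightarrow> bool" where
  "normalizes G H L \<longleftrightarrow> (\<forall>h\<in>H. \<forall>l\<in>L. h \<otimes>\<^bsub>G\<^esub> l \<otimes>\<^bsub>G\<^esub> inv\<^bsub>G\<^esub> h \<in> L)"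

declare lower_central.simps(2) [simp del]

context group
begin

section \<open>Group words, conjugation and products of subgroups\<close>

lemma inv_mult_cancel [simp]:
  "x \<in> carrier G \<Longrightarrow> y \<in> carrier G \<Longrightarrow> inv x \<otimes> (x \<otimes> y) = y"
  by (simp flip: m_assoc)

lemma mult_inv_cancel [simp]:
  "x \<in> carrier G \<Longrightarrow> y \<in> carrier G \<Longrightarrow> x \<otimes> (inv x \<otimes> y) = y"
  by (simp flip: m_assoc)

text \<open>With the two cancellation rules above, these equations bring both sides of a commutator
  identity to the same right-associated reduced word.\<close>

lemmas group_word = m_assoc inv_mult_group

abbreviation commutator :: "'a \<Rightarrow> 'a \<Rightarrow> 'a" where
  "commutator x y \<equiv> x \<otimes> y \<otimes> inv x \<otimes> inv y"

lemma normalizesD: "normalizes G H L \<Longrightarrow> h \<in> H \<Longrightarrow> l \<in> L \<Longrightarrow> h \<otimes> l \<otimes> inv h \<in> L"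
  by (simp add: normalizes_def)

lemma normalizesD':
  assumes "normalizes G H L" "subgroup H G" "h \<in> H" "l \<in> L"
  shows "inv h \<otimes> l \<otimes> h \<in> L"
  using normalizesD[OF assms(1), of "inv h" l] assms subgroup.m_inv_closed[OF assms(2)]
    subgroup.mem_carrier[OF assms(2)] by simp

lemma normalizes_mono: "normalizes G H L \<Longrightarrow> H' \<subseteq> H \<Longrightarrow> normalizes G H' L"
  by (auto simp: normalizes_def)

lemma normalizes_Int:
  assumes "normalizes G H L" "subgroup B G" "B \<subseteq> H"
  shows "normalizes G B (B \<inter> L)"
  using assms subgroup.m_closed[OF assms(2)] subgroup.m_inv_closed[OF assms(2)]
  by (auto simp: normalizes_def)

lemma conj_generate:
  assumes "Z \<subseteq> carrier G" "h \<in> carrier G" "\<And>x. x \<in> Z \<Longrightarrow> h \<otimes> x \<otimes> inv h \<in> generate G Z"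
    and "g \<in> generate G Z"
  shows "h \<otimes> g \<otimes> inv h \<in> generate G Z"
  using assms(4)
proof (induction rule: generate.induct)
  case one
  then show ?case using assms(2) by (simp add: generate.one)
next
  case (incl x)
  then show ?case using assms(3) by simp
next
  case (inv x)
  then have x: "x \<in> carrier G" using assms(1) by auto
  have "h \<otimes> inv x \<otimes> inv h = inv (h \<otimes> x \<otimes> inv h)"
    using x assms(2) by (simp add: group_word)
  then show ?case using generate_m_inv_closed[OF assms(1) assms(3)[OF inv]] by simp
next
  case (eng x y)
  then have x: "x \<in> carrier G" "y \<in> carrier G" using generate_in_carrier[OF assms(1)] by auto
  have "h \<otimes> (x \<otimes> y) \<otimes> inv h = (h \<otimes> x \<otimes> inv h) \<otimes> (h \<otimes> y \<otimes> inv h)"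
    using x assms(2) by (simp add: group_word)
  then show ?case using eng generate.eng by metis
qed

lemma subgroup_nat_pow_closed: "subgroup H G \<Longrightarrow> h \<in> H \<Longrightarrow> h [^] (n::nat) \<in> H"
  by (induction n) (auto intro: subgroup.m_closed subgroup.one_closed)

lemma set_multI: "s \<in> S \<Longrightarrow> l \<in> L \<Longrightarrow> s \<otimes> l \<in> S <#> L"
  by (auto simp: set_mult_def)

lemma set_multD: "x \<in> S <#> L \<Longrightarrow> \<exists>s\<in>S. \<exists>l\<in>L. x = s \<otimes> l"
  by (auto simp: set_mult_def)

lemma subgroup_set_mult:
  assumes S: "subgroup S G" and L: "subgroup L G" and n: "normalizes G S L"
  shows "subgroup (S <#> L) G"
proof
  note c = subgroup.mem_carrier[OF S] subgroup.mem_carrier[OF L]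
  show "S <#> L \<subseteq> carrier G" by (auto simp: set_mult_def c)
  show "\<one> \<in> S <#> L"
    using subgroup.one_closed[OF S] subgroup.one_closed[OF L]
    by (auto simp: set_mult_def intro!: bexI[of _ \<one>])
  fix x y assume "x \<in> S <#> L" "y \<in> S <#> L"
  then obtain s l s' l' where e: "s \<in> S" "l \<in> L" "s' \<in> S" "l' \<in> L" "x = s \<otimes> l" "y = s' \<otimes> l'"
    by (auto simp: set_mult_def)
  have "x \<otimes> y = (s \<otimes> s') \<otimes> ((inv s' \<otimes> l \<otimes> s') \<otimes> l')"
    using e c by (simp add: group_word)
  then show "x \<otimes> y \<in> S <#> L"
    using e normalizesD'[OF n S] subgroup.m_closed[OF S] subgroup.m_closed[OF L]
    by (simp add: set_multI)
next
  note c = subgroup.mem_carrier[OF S] subgroup.mem_carrier[OF L]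
  fix x assume "x \<in> S <#> L"
  then obtain s l where e: "s \<in> S" "l \<in> L" "x = s \<otimes> l"
    by (auto simp: set_mult_def)
  have "inv x = inv s \<otimes> (s \<otimes> inv l \<otimes> inv s)"
    using e c by (simp add: group_word)
  then show "inv x \<in> S <#> L"
    using e normalizesD[OF n] subgroup.m_inv_closed[OF S] subgroup.m_inv_closed[OF L]
    by (simp add: set_multI)
qed

lemma normalizes_of_commutators:
  assumes "subgroup L G" "subgroup H G" "\<And>l h. l \<in> L \<Longrightarrow> h \<in> H \<Longrightarrow> commutator l h \<in> L"
  shows "normalizes G H L"
  unfolding normalizes_def
proof (intro ballI)
  fix h l assume hl: "h \<in> H" "l \<in> L"
  note c = subgroup.mem_carrier[OF assms(1)] subgroup.mem_carrier[OF assms(2)]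
  have "h \<otimes> l \<otimes> inv h = l \<otimes> commutator (inv l) h"
    using hl c by (simp add: group_word)
  then show "h \<otimes> l \<otimes> inv h \<in> L"
    using hl assms subgroup.m_closed[OF assms(1)] subgroup.m_inv_closed[OF assms(1)] by simp
qed

lemma central_series_subgroup:
  assumes "central_series G H k L" "subgroup H G"
  shows "subgroup L G" "L \<subseteq> H" "normalizes G H L"
proof -
  have "subgroup L G \<and> L \<subseteq> H \<and> normalizes G H L"
    using assms(1)
  proof (induction rule: central_series.induct)
    case trivial
    then show ?case
      using triv_subgroup subgroup.one_closed[OF assms(2)] subgroup.mem_carrier[OF assms(2)]
      by (auto simp: normalizes_def)
  next
    case (step k L L' a)
    then show ?case
      using normalizes_of_commutators[OF step(2) assms(2)] by blast
  qed
  then show "subgroup L G" "L \<subseteq> H" "normalizes G H L" by auto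
qed

section \<open>The lower central series and its refinement\<close>

lemma lower_central_subgroup:
  assumes H: "subgroup H G"
  shows "subgroup (lower_central G H n) G \<and> lower_central G H n \<subseteq> H
    \<and> normalizes G H (lower_central G H n)"
proof (induction n)
  case 0
  then show ?case
    using H subgroup.m_closed[OF H] subgroup.m_inv_closed[OF H] by (auto simp: normalizes_def)
next
  case (Suc n)
  let ?A = "lower_central G H n"
  let ?Z = "{commutator a b | a b. a \<in> ?A \<and> b \<in> H}"
  note cH = subgroup.mem_carrier[OF H]
  have AH: "?A \<subseteq> H" "normalizes G H ?A" using Suc by auto
  have XH: "?Z \<subseteq> H" using AH subgroup.m_closed[OF H] subgroup.m_inv_closed[OF H] by auto
  then have Xc: "?Z \<subseteq> carrier G" using cH by blast
  \<comment> \<open>Conjugation respects commutators and preserves both \<open>?A\<close> and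
    \<open>H\<close>, so it maps generators to generators. This is why normality is carried along in
    the induction.\<close>
  have "h \<otimes> g \<otimes> inv h \<in> generate G ?Z" if h: "h \<in> H" and "g \<in> generate G ?Z" for h g
  proof (rule conj_generate[OF Xc])
    fix x assume "x \<in> ?Z"
    then obtain a b where x: "a \<in> ?A" "b \<in> H" "x = commutator a b" by auto
    have "h \<otimes> x \<otimes> inv h = commutator (h \<otimes> a \<otimes> inv h) (h \<otimes> b \<otimes> inv h)"
      using x h cH subsetD[OF AH(1)] by (simp add: group_word)
    moreover have "h \<otimes> a \<otimes> inv h \<in> ?A" "h \<otimes> b \<otimes> inv h \<in> H"
      using x h normalizesD[OF AH(2)] subgroup.m_closed[OF H] subgroup.m_inv_closed[OF H] by auto
    ultimately show "h \<otimes> x \<otimes> inv h \<in> generate G ?Z" by (auto intro!: generate.incl)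
  qed (use that cH in auto)
  then show ?case
    using generate_is_subgroup[OF Xc] generate_subgroup_incl[OF XH H]
    by (simp add: normalizes_def lower_central.simps)
qed

lemma lower_central_commutator:
  "a \<in> lower_central G H n \<Longrightarrow> b \<in> H \<Longrightarrow> commutator a b \<in> lower_central G H (Suc n)"
  by (auto simp: lower_central.simps intro!: generate.incl)

lemma lower_central_Suc_subset:
  assumes H: "subgroup H G"
  shows "lower_central G H (Suc n) \<subseteq> lower_central G H n"
proof -
  let ?A = "lower_central G H n"
  have A: "subgroup ?A G" "?A \<subseteq> H" "normalizes G H ?A"
    using lower_central_subgroup[OF H] by auto
  have "commutator a b \<in> ?A" if "a \<in> ?A" "b \<in> H" for a b
  proof -
    have "commutator a b = a \<otimes> (b \<otimes> inv a \<otimes> inv b)"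
      using that subgroup.mem_carrier[OF H] subgroup.mem_carrier[OF A(1)] by (simp add: group_word)
    then show ?thesis
      using that A subgroup.m_closed[OF A(1)] subgroup.m_inv_closed[OF A(1)] normalizesD[OF A(3)]
      by auto
  qed
  then show ?thesis
    unfolding lower_central.simps by (intro generate_subgroup_incl[OF _ A(1)]) auto
qed

text \<open>Modulo the next term but one, the commutator is bilinear, so commutators of generators
  suffice.\<close>
lemma lower_central_finitely_generated:
  assumes H: "subgroup H G" and S: "finite S" "S \<subseteq> carrier G" "generate G S = H"
  shows "\<exists>Z. finite Z \<and> Z \<subseteq> lower_central G H n \<and>
    lower_central G H n \<subseteq> generate G (Z \<union> lower_central G H (Suc n))"
proof (induction n)
  case 0
  have "S \<subseteq> H" using S by (auto intro: generate.incl)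
  then show ?case using S mono_generate[of S "S \<union> lower_central G H (Suc 0)"] by fastforce
next
  case (Suc n)
  let ?A = "lower_central G H n" and ?B = "lower_central G H (Suc n)"
    and ?C = "lower_central G H (Suc (Suc n))"
  note cH = subgroup.mem_carrier[OF H]
  have A: "subgroup ?A G" "?A \<subseteq> H" "normalizes G H ?A" and B: "subgroup ?B G" "?B \<subseteq> H" 
    and C: "subgroup ?C G" "?C \<subseteq> H" "normalizes G H ?C"
    using lower_central_subgroup[OF H] by auto
  have CB: "?C \<subseteq> ?B" and BA: "?B \<subseteq> ?A" using lower_central_Suc_subset[OF H] by auto
  have SH: "S \<subseteq> H" using S by (auto intro: generate.incl)
  obtain Z where Z: "finite Z" "Z \<subseteq> ?A" "?A \<subseteq> generate G (Z \<union> ?B)"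
    using Suc by auto
  define Y where "Y = (\<lambda>(s, t). commutator s t) ` (Z \<times> S)"
  have fY: "finite Y" using Z S by (auto simp: Y_def)
  have YB: "Y \<subseteq> ?B" using Z SH lower_central_commutator by (fastforce simp: Y_def)
  define W where "W = generate G (Y \<union> ?C)"
  have YC: "Y \<union> ?C \<subseteq> ?B" using YB CB by auto
  have YCc: "Y \<union> ?C \<subseteq> carrier G" using YC B cH by blast
  have W: "subgroup W G" unfolding W_def by (rule generate_is_subgroup[OF YCc])
  have WB: "W \<subseteq> ?B" unfolding W_def by (rule generate_subgroup_incl[OF YC B(1)])
  have CW: "?C \<subseteq> W" and YW: "Y \<subseteq> W" unfolding W_def by (auto intro: generate.incl)
  note clW = subgroup.m_closed[OF W] subgroup.m_inv_closed[OF W]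
  note clH = subgroup.m_closed[OF H] subgroup.m_inv_closed[OF H]
  \<comment> \<open>Elements of \<open>?B\<close> commute with \<open>H\<close> modulo
    \<open>?C\<close>, and \<open>?C\<close> lies in \<open>W\<close>. This makes \<open>W\<close>
    normalized by \<open>H\<close> and disposes of the generators of \<open>?A\<close> that come
    from \<open>?B\<close>.\<close>
  have BC: "commutator b h \<in> W" if "b \<in> ?B" "h \<in> H" for b h
    using that lower_central_commutator CW by blast
  have conjW: "h \<otimes> w \<otimes> inv h \<in> W" if w: "w \<in> W" and h: "h \<in> H" for w h
  proof -
    have c: "h \<in> carrier G" "w \<in> carrier G" using w h WB B cH by blast+
    then have "h \<otimes> w \<otimes> inv h = inv (commutator w h) \<otimes> w"
      by (simp add: group_word)
    then show ?thesis using clW(1)[OF clW(2)[OF BC[of w h]] w] w h WB by auto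
  qed
  \<comment> \<open>Here the second argument is built up from \<open>S\<close>; step
    \<open>2\<close> does the same for the first argument. A commutator with a product expands into
    conjugates of commutators, which \<open>conjW\<close> keeps inside \<open>W\<close>.\<close>
  have 1: "commutator s b \<in> W" if s: "s \<in> Z" and b: "b \<in> H" for s b
  proof -
    have sc: "s \<in> carrier G" and sH: "s \<in> H" using s Z A cH by auto
    have "b \<in> generate G S" using b S by simp
    then show ?thesis
    proof (induction rule: generate.induct)
      case one
      then show ?case using sc subgroup.one_closed[OF W] by simp
    next
      case (incl t)
      then show ?case using s YW by (auto simp: Y_def)
    next
      case (inv t)
      have "t \<in> H" using inv SH by auto
      have "commutator s (inv t) = inv t \<otimes> inv (commutator s t) \<otimes> inv (inv t)"
        using \<open>t \<in> H\<close> sc cH by (simp add: group_word)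
      moreover have "commutator s t \<in> W" using s inv YW by (auto simp: Y_def)
      ultimately show ?case using conjW[OF clW(2) clH(2)[OF \<open>t \<in> H\<close>]] by (simp only:)
    next
      case (eng b c)
      have bc: "b \<in> H" "c \<in> H" using eng S by auto
      have "commutator s (b \<otimes> c) = commutator s b \<otimes> (b \<otimes> commutator s c \<otimes> inv b)"
        using bc sc cH by (simp add: group_word)
      then show ?case using clW(1)[OF eng(3) conjW[OF eng(4) bc(1)]] by (simp only:)
    qed
  qed
  have 2: "commutator a b \<in> W" if a: "a \<in> ?A" and b: "b \<in> H" for a b
  proof -
    have bc: "b \<in> carrier G" using b cH by auto
    have XBA: "Z \<union> ?B \<subseteq> ?A" using Z BA by auto
    have XB: "commutator s b \<in> W" if "s \<in> Z \<union> ?B" for s using that 1 BC b by auto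
    have "a \<in> generate G (Z \<union> ?B)" using a Z by auto
    then show ?thesis
    proof (induction rule: generate.induct)
      case one
      then show ?case using bc subgroup.one_closed[OF W] by simp
    next
      case (incl s)
      then show ?case using XB by blast
    next
      case (inv s)
      have s: "s \<in> H" using inv XBA A by auto
      have "commutator (inv s) b = inv s \<otimes> inv (commutator s b) \<otimes> inv (inv s)"
        using s cH bc by (simp add: group_word)
      then show ?case using conjW[OF clW(2)[OF XB[OF inv]] clH(2)[OF s]] by (simp only:)
    next
      case (eng x y)
      have xy: "x \<in> H" "y \<in> H"
        using eng generate_subgroup_incl[OF XBA A(1)] A by auto
      have "commutator (x \<otimes> y) b = (x \<otimes> commutator y b \<otimes> inv x) \<otimes> commutator x b"
        using xy cH bc by (simp add: group_word)
      then show ?case using clW(1)[OF conjW[OF eng(4) xy(1)] eng(3)] by (simp only:)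
    qed
  qed
  have "{commutator a b |a b. a \<in> ?A \<and> b \<in> H} \<subseteq> W" using 2 by auto
  from generate_subgroup_incl[OF this W] have "?B \<subseteq> W" by (simp only: lower_central.simps)
  with fY YB show ?case unfolding W_def by (intro exI[of _ Y]) simp
qed

text \<open>Since \<open>[N, H]\<close> lies in \<open>M\<close>, the group \<open>N / M\<close> is
  central in \<open>H / M\<close>. The elements of \<open>Z\<close> can thus be adjoined one at a
  time, each giving a cyclic central factor.\<close>

lemma central_series_refine:
  assumes H: "subgroup H G" and M: "central_series G H k M"
    and N: "subgroup N G" "N \<subseteq> H" "\<And>g h. g \<in> N \<Longrightarrow> h \<in> H \<Longrightarrow> commutator g h \<in> M"
    and Z: "finite Z" "Z \<subseteq> N" "M \<subseteq> N"
  shows "\<exists>k'. central_series G H k' (generate G (Z \<union> M))"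
  using Z(1,2)
proof (induction Z rule: finite_induct)
  case empty
  have "generate G M = M"
    using central_series_subgroup[OF M H] generateI[of M M] by simp
  then show ?case using M by auto
next
  case (insert x Z)
  let ?L = "generate G (Z \<union> M)" and ?L' = "generate G (insert x Z \<union> M)"
  obtain k' where k': "central_series G H k' ?L" using insert by auto
  note L = central_series_subgroup[OF k' H]
  have sub: "insert x Z \<union> M \<subseteq> N" using insert Z by auto
  have c: "insert x Z \<union> M \<subseteq> carrier G" using sub subgroup.subset[OF N(1)] by auto
  have L': "subgroup ?L' G" by (rule generate_is_subgroup[OF c])
  have L'N: "?L' \<subseteq> N" by (rule generate_subgroup_incl[OF sub N(1)])
  have LL': "?L \<subseteq> ?L'" by (rule mono_generate) auto
  have x: "x \<in> ?L'" by (auto intro: generate.incl)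
  have xc: "x \<in> carrier G" and xH: "x \<in> H" using c x L'N N by auto
  have pow: "x [^] (t::int) \<in> H" for t using xH subgroup_int_pow_closed[OF H] by auto
  note cL = subgroup.mem_carrier[OF L(1)] and clL = subgroup.m_closed[OF L(1)] subgroup.m_inv_closed[OF L(1)]
  let ?T = "range (\<lambda>t::int. x [^] t)"
  have T: "subgroup ?T G"
  proof
    show "?T \<subseteq> carrier G" using xc by auto
    show "\<one> \<in> ?T" using int_pow_0[of G x] by (metis rangeI)
    show "a \<otimes> b \<in> ?T" if "a \<in> ?T" "b \<in> ?T" for a b
      using that by (auto simp flip: int_pow_mult[OF xc])
    show "inv a \<in> ?T" if "a \<in> ?T" for a
      using that by (auto simp flip: int_pow_neg[OF xc])
  qed
  \<comment> \<open>The powers of \<open>x\<close> normalize \<open>?L\<close>, so this product is a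
    subgroup. It contains all generators of \<open>?L'\<close>, whence every element of
    \<open>?L'\<close> has the form \<open>x [^] t \<otimes> l\<close>.\<close>
  have "subgroup (?T <#> ?L) G"
    by (rule subgroup_set_mult[OF T L(1) normalizes_mono[OF L(3)]]) (use pow in auto)
  moreover have "insert x Z \<union> M \<subseteq> ?T <#> ?L"
  proof -
    have "x [^] (1::int) \<otimes> \<one> = x" using xc by simp
    then have "x \<in> ?T <#> ?L" using set_multI[OF rangeI generate.one] by metis
    moreover have "l \<in> ?T <#> ?L" if "l \<in> ?L" for l
    proof -
      have "x [^] (0::int) \<otimes> l = l" using cL[OF that] by simp
      then show ?thesis using set_multI[OF rangeI that] by metis
    qed
    ultimately show ?thesis using generate.incl[of _ "Z \<union> M" G] by blast
  qed
  ultimately have "?L' \<subseteq> ?T <#> ?L" by (intro generate_subgroup_incl)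
  then have "g \<in> ?T <#> ?L" if "g \<in> ?L'" for g
    using that by blast
  then have "\<exists>t::int. \<exists>l\<in>?L. g = x [^] t \<otimes> l" if "g \<in> ?L'" for g
    using that unfolding set_mult_def by blast
  moreover have "commutator g h \<in> ?L" if "g \<in> ?L'" "h \<in> H" for g h
    by (rule generate.incl) (use N(3)[of g h] that L'N in blast)
  ultimately have "central_series G H (Suc k') ?L'"
    using L'N N(2) by (intro central_series.step[OF k' L' LL' _ x]) blast+
  then show ?case by blast
qed

text \<open>Going up from the trivial term of the lower central series, each factor is central and,
  because \<open>H\<close> is finitely generated, finitely generated. It is therefore climbed in
  finitely many cyclic steps.\<close>

theorem central_series_exists:
  assumes "finitely_generated_subgroup G H" "nilpotent_subgroup G H"
  shows "\<exists>k. central_series G H k H"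
proof -
  have H: "subgroup H G" using assms by (simp add: nilpotent_subgroup_def)
  obtain S where S: "finite S" "S \<subseteq> carrier G" "generate G S = H"
    using assms by (auto simp: finitely_generated_subgroup_def)
  obtain c where c: "lower_central G H c = {\<one>}" using assms by (auto simp: nilpotent_subgroup_def)
  have "\<exists>k. central_series G H k (lower_central G H 0)"
  proof (rule inc_induct[of 0 c])
    show "\<exists>k. central_series G H k (lower_central G H c)"
      using c central_series.trivial[of G H] by auto
    fix n assume "\<exists>k. central_series G H k (lower_central G H (Suc n))"
    then obtain k where k: "central_series G H k (lower_central G H (Suc n))" by blast
    note A = lower_central_subgroup[OF H, of n]
    obtain Z where Z: "finite Z" "Z \<subseteq> lower_central G H n"
      "lower_central G H n \<subseteq> generate G (Z \<union> lower_central G H (Suc n))"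
      using lower_central_finitely_generated[OF H S] by blast
    have "generate G (Z \<union> lower_central G H (Suc n)) \<subseteq> lower_central G H n"
      using Z lower_central_Suc_subset[OF H] A by (intro generate_subgroup_incl) auto
    then have "generate G (Z \<union> lower_central G H (Suc n)) = lower_central G H n"
      using Z by auto
    moreover have "\<exists>k. central_series G H k (generate G (Z \<union> lower_central G H (Suc n)))"
      using A Z lower_central_commutator lower_central_Suc_subset[OF H]
      by (intro central_series_refine[OF H k, of "lower_central G H n"]) blast+
    ultimately show "\<exists>k. central_series G H k (lower_central G H n)" by simp
  qed simp
  then show ?thesis by simp
qed

end

section \<open>Powers and indices\<close>

context group
begin

text \<open>Relative indices are written as the number of right cosets of the smaller group that meet the
  larger one.\<close>
lemma card_cosets_tower:
  assumes A: "subgroup A G" and B: "subgroup B G" and C: "subgroup C G" and "A \<subseteq> B" "B \<subseteq> C"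
  shows "card ((#>) A ` C) = card ((#>) A ` B) * card ((#>) B ` C)"
proof -
  note c = subgroup.mem_carrier[OF A] subgroup.mem_carrier[OF B] subgroup.mem_carrier[OF C]
  note sub = subgroup.subset[OF A] subgroup.subset[OF B] subgroup.subset[OF C]
  define r where "r = inv_into C ((#>) B)"
  have r: "r y \<in> C" "B #> r y = y" if "y \<in> (#>) B ` C" for y
    using inv_into_into[OF that] f_inv_into_f[OF that] unfolding r_def by auto
  \<comment> \<open>With a fixed representative \<open>r y\<close> of each coset of \<open>B\<close>
    in \<open>C\<close>, the cosets of \<open>A\<close> in \<open>C\<close> are the
    \<open>A #> (b \<otimes> r y)\<close>. Multiplying the coset \<open>u\<close> itself makes the
    map independent of the choice of \<open>b\<close>.\<close>
  let ?f = "\<lambda>(u, y). u #> r y"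
  have f: "(A #> b) #> r y = A #> (b \<otimes> r y)" if "b \<in> B" "y \<in> (#>) B ` C" for b y
    using coset_mult_assoc[OF sub(1)] that c r by blast
  have inj: "A #> b = A #> b' \<and> y = y'"
    if b: "b \<in> B" "b' \<in> B" and y: "y \<in> (#>) B ` C" "y' \<in> (#>) B ` C"
      and e: "A #> (b \<otimes> r y) = A #> (b' \<otimes> r y')" for b b' y y'
  proof -
    have cc: "b \<in> carrier G" "b' \<in> carrier G" "r y \<in> carrier G" "r y' \<in> carrier G"
      using b y r c by blast+
    have "b \<otimes> r y \<in> A #> (b' \<otimes> r y')"
      using rcos_self[OF _ A, of "b \<otimes> r y"] e cc by simp
    then obtain a where a: "a \<in> A" "b \<otimes> r y = a \<otimes> (b' \<otimes> r y')"
      by (auto simp: r_coset_def)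
    have ac: "a \<in> carrier G" using a c by blast
    have "r y = inv b \<otimes> (b \<otimes> r y)" using cc by simp
    also have "\<dots> = (inv b \<otimes> a \<otimes> b') \<otimes> r y'" using a ac cc by (simp add: group_word)
    finally have "r y = (inv b \<otimes> a \<otimes> b') \<otimes> r y'" .
    moreover have "inv b \<otimes> a \<otimes> b' \<in> B"
      using a b \<open>A \<subseteq> B\<close> by (intro subgroup.m_closed[OF B] subgroup.m_inv_closed[OF B]) auto
    ultimately have "r y \<in> B #> r y'" by (auto simp: r_coset_def)
    then have "B #> r y' = B #> r y" by (rule repr_independence[OF _ cc(4) B])
    then have yy: "y = y'" using r y by metis
    have "A #> (b \<otimes> r y) #> inv (r y) = A #> (b' \<otimes> r y) #> inv (r y)"
      using e yy by simp
    then have "A #> b = A #> b'"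
      using cc sub by (simp add: coset_mult_assoc group_word)
    then show ?thesis using yy by simp
  qed
  have "inj_on ?f ((#>) A ` B \<times> (#>) B ` C)"
  proof (rule inj_onI)
    fix p q assume p: "p \<in> (#>) A ` B \<times> (#>) B ` C" and q: "q \<in> (#>) A ` B \<times> (#>) B ` C"
      and e: "?f p = ?f q"
    obtain b y where b: "b \<in> B" "y \<in> (#>) B ` C" "p = (A #> b, y)" using p by blast
    obtain b' y' where b': "b' \<in> B" "y' \<in> (#>) B ` C" "q = (A #> b', y')" using q by blast
    have "A #> (b \<otimes> r y) = A #> (b' \<otimes> r y')"
      using e f[OF b(1,2)] f[OF b'(1,2)] unfolding b(3) b'(3) by simp
    then show "p = q" using inj[OF b(1) b'(1) b(2) b'(2)] b b' by simp
  qed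
  moreover have "?f ` ((#>) A ` B \<times> (#>) B ` C) = (#>) A ` C"
  proof (intro subset_antisym subsetI)
    fix z assume "z \<in> ?f ` ((#>) A ` B \<times> (#>) B ` C)"
    then obtain b y where b: "b \<in> B" "y \<in> (#>) B ` C" "z = A #> b #> r y" by blast
    moreover have "b \<otimes> r y \<in> C"
      using b r \<open>B \<subseteq> C\<close> by (intro subgroup.m_closed[OF C]) auto
    ultimately show "z \<in> (#>) A ` C" using f[OF b(1,2)] by simp
  next
    fix z assume "z \<in> (#>) A ` C"
    then obtain x where x: "x \<in> C" "z = A #> x" by blast
    define y where "y = B #> x"
    have y: "y \<in> (#>) B ` C" using x y_def by blast
    have "x \<in> B #> x" using rcos_self[OF _ B] x c by blast
    then have "x \<in> B #> r y" using r(2)[OF y] y_def by simp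
    then obtain b where b: "b \<in> B" "x = b \<otimes> r y" by (auto simp: r_coset_def)
    have "z = ?f (A #> b, y)" using f[OF b(1) y] x b by simp
    then show "z \<in> ?f ` ((#>) A ` B \<times> (#>) B ` C)" using b y by blast
  qed
  ultimately have "card ((#>) A ` C) = card ((#>) A ` B \<times> (#>) B ` C)"
    using card_image by metis
  then show ?thesis by (simp add: card_cartesian_product)
qed

lemma rcosets_image: "rcosets A = (#>) A ` carrier G"
  by (auto simp: RCOSETS_def)

text \<open>Lagrange's theorem in \<open>R / T\<close>. For an infinite index \<open>card\<close> is
  0, and the claim becomes that \<open>\<one>\<close> lies in \<open>T\<close>.\<close>

lemma pow_relative_index:
  assumes T: "subgroup T G" and R: "subgroup R G" and "T \<subseteq> R" "normalizes G R T" "h \<in> R"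
  shows "h [^] card ((#>) T ` R) \<in> T"
proof -
  interpret R: group "G\<lparr>carrier := R\<rparr>" by (rule subgroup.subgroup_is_group[OF R is_group])
  have "x \<otimes>\<^bsub>G\<lparr>carrier := R\<rparr>\<^esub> t \<otimes>\<^bsub>G\<lparr>carrier := R\<rparr>\<^esub> inv\<^bsub>G\<lparr>carrier := R\<rparr>\<^esub> x \<in> T"
    if "x \<in> R" "t \<in> T" for x t
    using normalizesD[OF assms(4) that] m_inv_consistent[OF R that(1)] by simp
  then have "T \<lhd> G\<lparr>carrier := R\<rparr>"
    unfolding R.normal_inv_iff using subgroup_incl[OF T R \<open>T \<subseteq> R\<close>] by simp
  then interpret T: normal T "G\<lparr>carrier := R\<rparr>" .
  interpret Q: group "G\<lparr>carrier := R\<rparr> Mod T" by (rule T.factorgroup_is_group)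
  have coset: "T #>\<^bsub>G\<lparr>carrier := R\<rparr>\<^esub> x = T #> x" for x by (simp add: r_coset_def)
  have "order (G\<lparr>carrier := R\<rparr> Mod T) = card ((#>) T ` R)"
    by (simp add: order_def carrier_FactGroup coset)
  moreover have "(T #> h) [^]\<^bsub>G\<lparr>carrier := R\<rparr> Mod T\<^esub> order (G\<lparr>carrier := R\<rparr> Mod T)
      = \<one>\<^bsub>G\<lparr>carrier := R\<rparr> Mod T\<^esub>"
    by (rule Q.pow_order_eq_1) (use assms in \<open>simp add: carrier_FactGroup coset\<close>)
  moreover have "(T #> h) [^]\<^bsub>G\<lparr>carrier := R\<rparr> Mod T\<^esub> (n::nat) = T #> (h [^] n)" for n
    using T.FactGroup_pow[of h n] assms by (simp add: coset nat_pow_consistent[symmetric])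
  ultimately have "T #> (h [^] card ((#>) T ` R)) = T" by simp
  moreover have "h [^] card ((#>) T ` R) \<in> carrier G"
    using subgroup.mem_carrier[OF R] assms by simp
  ultimately show ?thesis using rcos_self[OF _ T] by metis
qed

text \<open>A subgroup of a nilpotent group is subnormal, and the successive indices of the subnormal
  chain \<open>S <#> L\<close> divide the total index.\<close>
lemma central_series_pow_mem:
  assumes cs: "central_series G H k L" and H: "subgroup H G" and S: "subgroup S G" "S \<subseteq> H"
    and "h \<in> S <#> L"
  shows "h [^] (card (rcosets S) ^ k) \<in> S"
  using cs assms(5)
proof (induction arbitrary: h rule: central_series.induct)
  case trivial
  then show ?case using subgroup.mem_carrier[OF S(1)] by (auto simp: set_mult_def rcosets_image)
next
  case (step k L L' a)
  let ?m = "card (rcosets S)"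
  note cL = central_series_subgroup[OF step(1) H]
  have L': "subgroup L' G" "L' \<subseteq> H" "normalizes G H L'"
    using central_series_subgroup[OF central_series.step[OF step(1-7)] H] by auto
  have T: "subgroup (S <#> L) G" and R: "subgroup (S <#> L') G"
    using subgroup_set_mult[OF S(1) cL(1) normalizes_mono[OF cL(3) S(2)]]
      subgroup_set_mult[OF S(1) L'(1) normalizes_mono[OF L'(3) S(2)]] by auto
  note cH = subgroup.mem_carrier[OF H]
  have ST: "S \<subseteq> S <#> L"
  proof
    fix s assume s: "s \<in> S"
    then show "s \<in> S <#> L"
      using set_multI[OF s subgroup.one_closed[OF cL(1)]] subgroup.mem_carrier[OF S(1) s] by simp
  qed
  have TR: "S <#> L \<subseteq> S <#> L'" using \<open>L \<subseteq> L'\<close> by (auto simp: set_mult_def)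
  have TH: "S <#> L \<subseteq> H"
    unfolding set_mult_def using S(2) cL(2) by (auto intro!: subgroup.m_closed[OF H])
  \<comment> \<open>\<open>S\<close> lies in \<open>S <#> L\<close>, and an element of
    \<open>L'\<close> commutes with every element of \<open>H\<close> up to a factor in
    \<open>L\<close>.\<close>
  have "normalizes G (S <#> L') (S <#> L)"
    unfolding normalizes_def
  proof (intro ballI)
    fix r t assume "r \<in> S <#> L'" and t: "t \<in> S <#> L"
    then obtain s l where r: "s \<in> S" "l \<in> L'" "r = s \<otimes> l" by (auto simp: set_mult_def)
    have c: "s \<in> carrier G" "l \<in> carrier G" "t \<in> carrier G"
      using r t S L' TH cH by blast+
    have "r \<otimes> t \<otimes> inv r = s \<otimes> (commutator l t \<otimes> t) \<otimes> inv s"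
      using c r by (simp add: group_word)
    moreover have "commutator l t \<in> S <#> L"
    proof -
      have m: "commutator l t \<in> L" using step(7)[of l t] r t TH by auto
      then show ?thesis
        using set_multI[OF subgroup.one_closed[OF S(1)] m] subgroup.mem_carrier[OF cL(1) m] by simp
    qed
    ultimately show "r \<otimes> t \<otimes> inv r \<in> S <#> L"
      using t subsetD[OF ST r(1)]
      by (metis (no_types) T subgroup.m_closed subgroup.m_inv_closed)
  qed
  from pow_relative_index[OF T R TR this step.prems]
  have p: "h [^] card ((#>) (S <#> L) ` (S <#> L')) \<in> S <#> L" .
  have "?m = card ((#>) S ` (S <#> L)) * (card ((#>) (S <#> L) ` (S <#> L'))
      * card ((#>) (S <#> L') ` carrier G))"
    using card_cosets_tower[OF S(1) T subgroup_self ST] card_cosets_tower[OF T R subgroup_self TR]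
      subgroup.subset[OF T] subgroup.subset[OF R] by (simp add: rcosets_image)
  then have "?m = card ((#>) (S <#> L) ` (S <#> L')) * (card ((#>) S ` (S <#> L))
      * card ((#>) (S <#> L') ` carrier G))" by (simp only: ac_simps)
  then obtain q where q: "?m = card ((#>) (S <#> L) ` (S <#> L')) * q" ..
  have hc: "h \<in> carrier G" using step.prems subgroup.mem_carrier[OF R] by auto
  \<comment> \<open>Each descent in the series costs one exponent \<open>?m\<close>, so
    \<open>k\<close> descents cost \<open>?m ^ k\<close>.\<close>
  have "h [^] ?m \<in> S <#> L"
    unfolding q using subgroup_nat_pow_closed[OF T p, of q] nat_pow_pow[OF hc] by simp
  from step.IH[OF this] show ?case using nat_pow_pow[OF hc] by simp
qed

text \<open>Left multiplication by \<open>g\<close> carries the coset \<open>S' #> c\<close> to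
  \<open>S #> (g \<otimes> c)\<close>. The spectrum only records the index of the stabilizer of
  \<open>U j\<close> itself; this transfers it to the stabilizers of the translates.\<close>

lemma rcosets_conj:
  assumes S: "subgroup S G" and g: "g \<in> carrier G"
  defines "S' \<equiv> {h \<in> carrier G. g \<otimes> h \<otimes> inv g \<in> S}"
  shows "subgroup S' G" "card (rcosets S') = card (rcosets S)"
proof -
  note cS = subgroup.mem_carrier[OF S]
  show "subgroup S' G"
  proof
    show "x \<otimes> y \<in> S'" if "x \<in> S'" "y \<in> S'" for x y
    proof -
      have "g \<otimes> (x \<otimes> y) \<otimes> inv g = (g \<otimes> x \<otimes> inv g) \<otimes> (g \<otimes> y \<otimes> inv g)"
        using that g by (simp add: S'_def group_word)
      also have "\<dots> \<in> S" using that by (auto simp: S'_def simp del: m_assoc intro: subgroup.m_closed[OF S])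
      finally show ?thesis using that by (simp add: S'_def)
    qed
    show "inv x \<in> S'" if "x \<in> S'" for x
    proof -
      have "g \<otimes> inv x \<otimes> inv g = inv (g \<otimes> x \<otimes> inv g)"
        using that g by (simp add: S'_def group_word)
      also have "\<dots> \<in> S" using that by (auto simp: S'_def intro: subgroup.m_inv_closed[OF S])
      finally show ?thesis using that by (simp add: S'_def)
    qed
    show "\<one> \<in> S'" using g subgroup.one_closed[OF S] by (simp add: S'_def)
  qed (auto simp: S'_def)
  let ?f = "\<lambda>D. (\<otimes>) g ` D"
  have f: "?f (S' #> c) = S #> (g \<otimes> c)" if c: "c \<in> carrier G" for c
  proof (intro subset_antisym subsetI)
    fix z assume "z \<in> ?f (S' #> c)"
    then obtain s where s: "s \<in> carrier G" "g \<otimes> s \<otimes> inv g \<in> S" "z = g \<otimes> (s \<otimes> c)"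
      by (auto simp: r_coset_def S'_def)
    then have "z = (g \<otimes> s \<otimes> inv g) \<otimes> (g \<otimes> c)" using g c by (simp add: group_word)
    then show "z \<in> S #> (g \<otimes> c)" using s(2) by (auto simp: r_coset_def)
  next
    fix z assume "z \<in> S #> (g \<otimes> c)"
    then obtain s where s: "s \<in> S" "z = s \<otimes> (g \<otimes> c)" by (auto simp: r_coset_def)
    have "inv g \<otimes> s \<otimes> g \<in> S'" using g s cS[OF s(1)] by (simp add: S'_def group_word)
    moreover have "z = g \<otimes> ((inv g \<otimes> s \<otimes> g) \<otimes> c)" using g c s cS[OF s(1)] by (simp add: group_word)
    ultimately show "z \<in> ?f (S' #> c)" unfolding r_coset_def by blast
  qed
  have "?f ` (rcosets S') = rcosets S"
  proof (intro subset_antisym subsetI)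
    fix D assume "D \<in> ?f ` (rcosets S')"
    then obtain c where "c \<in> carrier G" "D = ?f (S' #> c)" by (auto simp: RCOSETS_def)
    then show "D \<in> rcosets S" using f g subgroup.subset[OF S] by (auto intro: rcosetsI)
  next
    fix D assume "D \<in> rcosets S"
    then obtain c where c: "c \<in> carrier G" "D = S #> c" by (auto simp: RCOSETS_def)
    then have "D = ?f (S' #> (inv g \<otimes> c))" using f[of "inv g \<otimes> c"] g by simp
    moreover have "S' #> (inv g \<otimes> c) \<in> rcosets S'"
      using c g by (intro rcosetsI) (auto simp: S'_def)
    ultimately show "D \<in> ?f ` (rcosets S')" by blast
  qed
  moreover have "inj_on ?f (rcosets S')"
  proof (rule inj_on_image)
    have "\<Union> (rcosets S') \<subseteq> carrier G" by (auto simp: RCOSETS_def r_coset_def S'_def)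
    then show "inj_on ((\<otimes>) g) (\<Union> (rcosets S'))"
      by (rule inj_on_subset[OF inj_on_cmult[OF g]])
  qed
  ultimately show "card (rcosets S') = card (rcosets S)" using card_image by metis
qed

text \<open>The cosets of \<open>S \<inter> H\<close> in \<open>S\<close> embed into the cosets of
  \<open>H\<close> in the whole group. So their number is at most the index of \<open>H\<close>, but
  it need not divide it when \<open>H\<close> is not normal; the factorial repairs this.\<close>

lemma card_rcosets_Int_dvd:
  assumes S: "subgroup S G" and H: "subgroup H G" and fin: "finite (rcosets H)"
  shows "card (rcosets (S \<inter> H)) dvd card (rcosets S) * fact (card (rcosets H))"
proof -
  have SH: "subgroup (S \<inter> H) G" by (rule subgroups_Inter_pair[OF S H])
  note cS = subgroup.mem_carrier[OF S]
  have eq: "(S \<inter> H) #> s = (S \<inter> H) #> t" if st: "s \<in> S" "t \<in> S" and e: "H #> s = H #> t" for s t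
  proof -
    have c: "s \<in> carrier G" "t \<in> carrier G" using st cS by auto
    have "s \<in> H #> t" using e rcos_self[OF c(1) H] by simp
    then obtain h where h: "h \<in> H" "s = h \<otimes> t" by (auto simp: r_coset_def)
    have "h = s \<otimes> inv t" using h c subgroup.mem_carrier[OF H] by (simp add: group_word)
    also have "\<dots> \<in> S" by (intro subgroup.m_closed[OF S] subgroup.m_inv_closed[OF S] st)
    finally have "h \<in> S \<inter> H" using h by simp
    then have "s \<in> (S \<inter> H) #> t" using h by (auto simp: r_coset_def)
    from repr_independence[OF this c(2) SH] show ?thesis by simp
  qed
  let ?c = "card ((#>) (S \<inter> H) ` S)"
  define r where "r D = (SOME s. s \<in> S \<and> D = (S \<inter> H) #> s)" for D
  have r: "r D \<in> S" "(S \<inter> H) #> r D = D" if "D \<in> (#>) (S \<inter> H) ` S" for D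
  proof -
    have "\<exists>s. s \<in> S \<and> D = (S \<inter> H) #> s" using that by blast
    from someI_ex[OF this] show "r D \<in> S" "(S \<inter> H) #> r D = D" by (auto simp: r_def)
  qed
  have inj: "inj_on (\<lambda>D. H #> r D) ((#>) (S \<inter> H) ` S)"
  proof (rule inj_onI)
    fix D E assume "D \<in> (#>) (S \<inter> H) ` S" "E \<in> (#>) (S \<inter> H) ` S" "H #> r D = H #> r E"
    then show "D = E" using eq[OF r(1) r(1)] r(2) by metis
  qed
  have img: "(\<lambda>D. H #> r D) ` (#>) (S \<inter> H) ` S \<subseteq> rcosets H"
    using r(1) cS subgroup.subset[OF H] by (blast intro: rcosetsI)
  have "?c \<le> card (rcosets H)" by (rule card_inj_on_le[OF inj img fin])
  moreover have "?c > 0"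
    using finite_subset[OF img fin] inj subgroup.one_closed[OF S]
    by (auto simp: card_gt_0_iff dest: finite_imageD)
  ultimately have "?c dvd fact (card (rcosets H))" by (intro dvd_fact) auto
  then show ?thesis
    using card_cosets_tower[OF SH S subgroup_self _ subgroup.subset[OF S]]
    by (simp add: rcosets_image mult.commute mult_dvd_mono)
qed

end

text \<open>Each prime factor split off from \<open>m\<close> raises the exponent by one. Indices at
  different levels thus divide powers of one base, and only the exponent varies.\<close>

lemma dvd_power_prod_primes:
  fixes m :: nat
  assumes "finite Q" "m > 0" "\<And>p. Factorial_Ring.prime p \<Longrightarrow> p dvd m \<Longrightarrow> p \<in> Q"
  shows "\<exists>n. m dvd (\<Prod>Q) ^ n"
  using assms(2,3)
proof (induction m rule: less_induct)
  case (less m)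
  show ?case
  proof (cases "m = 1")
    case True
    then show ?thesis by simp
  next
    case False
    then obtain p where p: "Factorial_Ring.prime p" "p dvd m" using prime_factor_nat by blast
    then obtain m' where m': "m = p * m'" by (auto elim: dvdE)
    have "m' < m" "m' > 0" using less(2) m' prime_gt_1_nat[OF p(1)] by auto
    then obtain n where "m' dvd (\<Prod>Q) ^ n" using less.IH[of m'] less(3) m' by auto
    moreover have "p dvd \<Prod>Q" using dvd_prodI[OF assms(1) less(3)[OF p], of "\<lambda>x. x"] by simp
    ultimately have "m dvd (\<Prod>Q) ^ Suc n" unfolding m' by (simp add: mult_dvd_mono)
    then show ?thesis by blast
  qed
qed

section \<open>Frattini argument\<close>

context group
begin

text \<open>This is \<open>B^P [B, B]\<close>, the kernel of the largest abelian quotient of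
  \<open>B\<close> of exponent dividing \<open>P\<close>. It takes the place of the Frattini
  subgroup.\<close>

definition power_comm :: "nat \<Rightarrow> 'a set \<Rightarrow> 'a set" where
  "power_comm P B = generate G
     ({b [^] P | b. b \<in> B} \<union> {commutator a b | a b. a \<in> B \<and> b \<in> B})"

lemma power_comm_pow: "b \<in> B \<Longrightarrow> b [^] P \<in> power_comm P B"
  unfolding power_comm_def by (rule generate.incl) auto

lemma power_comm_commutator: "a \<in> B \<Longrightarrow> b \<in> B \<Longrightarrow> commutator a b \<in> power_comm P B"
  unfolding power_comm_def by (rule generate.incl) auto

lemma power_comm_mono: "B \<subseteq> B' \<Longrightarrow> power_comm P B \<subseteq> power_comm P B'"
  unfolding power_comm_def by (rule mono_generate) auto

lemma power_comm_subgroup: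
  assumes B: "subgroup B G"
  shows "subgroup (power_comm P B) G" "power_comm P B \<subseteq> B" "normalizes G B (power_comm P B)"
proof -
  have gens: "{b [^] P | b. b \<in> B} \<union> {commutator a b | a b. a \<in> B \<and> b \<in> B} \<subseteq> B"
    by (auto intro!: subgroup.m_closed[OF B] subgroup.m_inv_closed[OF B] subgroup_nat_pow_closed[OF B])
  show 1: "subgroup (power_comm P B) G" unfolding power_comm_def
    using gens subgroup.subset[OF B] by (intro generate_is_subgroup) blast
  show 2: "power_comm P B \<subseteq> B"
    unfolding power_comm_def by (rule generate_subgroup_incl[OF gens B])
  show "normalizes G B (power_comm P B)"
    by (rule normalizes_of_commutators[OF 1 B]) (use 2 power_comm_commutator in blast)
qed

text \<open>In the abelian group \<open>B / T\<close> every element is a \<open>P\<close>-th power, hence a \<open>P ^ n\<close>-th power,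
  hence trivial.\<close>
lemma subset_of_power_comm_abelian:
  assumes B: "subgroup B G" and T: "subgroup T G" "T \<subseteq> B" "normalizes G B T"
    and comm: "\<And>a b. a \<in> B \<Longrightarrow> b \<in> B \<Longrightarrow> commutator a b \<in> T"
    and gen: "B \<subseteq> T <#> power_comm P B" and pow: "\<And>b. b \<in> B \<Longrightarrow> b [^] (P ^ n) \<in> T"
  shows "B \<subseteq> T"
proof -
  let ?B = "G\<lparr>carrier := B\<rparr>"
  interpret B: group ?B by (rule subgroup.subgroup_is_group[OF B is_group])
  have "x \<otimes>\<^bsub>?B\<^esub> t \<otimes>\<^bsub>?B\<^esub> inv\<^bsub>?B\<^esub> x \<in> T" if "x \<in> B" "t \<in> T" for x t
    using normalizesD[OF T(3) that] m_inv_consistent[OF B that(1)] by simp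
  then have "T \<lhd> ?B"
    unfolding B.normal_inv_iff using subgroup_incl[OF T(1) B T(2)] by simp
  then interpret T: normal T ?B .
  let ?Q = "?B Mod T"
  interpret Q: group ?Q by (rule T.factorgroup_is_group)
  have coset: "T #>\<^bsub>?B\<^esub> x = T #> x" for x by (simp add: r_coset_def)
  define \<phi> where "\<phi> x = T #> x" for x
  have carrier: "carrier ?Q = \<phi> ` B"
    by (simp add: carrier_FactGroup coset \<phi>_def)
  have mult: "\<phi> (x \<otimes> y) = \<phi> x \<otimes>\<^bsub>?Q\<^esub> \<phi> y" if "x \<in> B" "y \<in> B" for x y
    using T.rcos_sum[of x y] that by (simp add: \<phi>_def coset)
  have pow': "\<phi> (x [^] (m::nat)) = \<phi> x [^]\<^bsub>?Q\<^esub> m" if "x \<in> B" for x m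
    using T.FactGroup_pow[of x m] that by (simp add: \<phi>_def coset nat_pow_consistent[symmetric])
  have trivial: "\<phi> t = \<one>\<^bsub>?Q\<^esub>" if "t \<in> T" for t
    using that coset_join2[OF _ T(1)] subgroup.mem_carrier[OF T(1)] by (simp add: \<phi>_def)
  note cB = subgroup.mem_carrier[OF B] and clB = subgroup.m_closed[OF B] subgroup.m_inv_closed[OF B]
  have QC: "\<phi> x \<in> carrier ?Q" if "x \<in> B" for x using that carrier by simp
  have \<phi>comm: "\<phi> x \<otimes>\<^bsub>?Q\<^esub> \<phi> y = \<phi> y \<otimes>\<^bsub>?Q\<^esub> \<phi> x" if "x \<in> B" "y \<in> B" for x y
  proof -
    have "x \<otimes> y = commutator x y \<otimes> (y \<otimes> x)" using cB[OF that(1)] cB[OF that(2)] by (simp add: group_word)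
    then have "\<phi> (x \<otimes> y) = \<phi> (commutator x y) \<otimes>\<^bsub>?Q\<^esub> \<phi> (y \<otimes> x)"
      using mult[of "commutator x y" "y \<otimes> x"] subsetD[OF T(2) comm[OF that]] clB(1)[OF that(2,1)]
      by (simp only:)
    then show ?thesis
      by (simp only: trivial[OF comm[OF that]] mult that Q.l_one[OF Q.m_closed[OF QC QC]])
  qed
  interpret Q: comm_group ?Q
    by (rule Q.group_comm_groupI) (unfold carrier, elim imageE, simp only: \<phi>comm)
  have \<phi>inv: "\<phi> (inv x) = inv\<^bsub>?Q\<^esub> (\<phi> x)" if "x \<in> B" for x
  proof (rule Q.inv_equality[symmetric])
    show "\<phi> (inv x) \<otimes>\<^bsub>?Q\<^esub> \<phi> x = \<one>\<^bsub>?Q\<^esub>"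
      using mult[OF clB(2)[OF that] that] trivial[OF subgroup.one_closed[OF T(1)]] cB[OF that]
      by simp
  qed (use QC that clB in auto)
  have trivial': "\<exists>c\<in>B. \<phi> v = \<phi> c [^]\<^bsub>?Q\<^esub> P" if "v \<in> T" for v
  proof (rule bexI[OF _ subgroup.one_closed[OF B]])
    show "\<phi> v = \<phi> \<one> [^]\<^bsub>?Q\<^esub> P"
      by (simp only: trivial[OF that] trivial[OF subgroup.one_closed[OF T(1)]] Q.nat_pow_one)
  qed
  \<comment> \<open>In the abelian quotient commutators vanish and a product of \<open>P\<close>-th
    powers is a \<open>P\<close>-th power, so every class of \<open>power_comm P B\<close> is a
    single \<open>P\<close>-th power.\<close>
  have power: "\<exists>c\<in>B. \<phi> v = \<phi> c [^]\<^bsub>?Q\<^esub> P" if "v \<in> power_comm P B" for v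
    using that unfolding power_comm_def
  proof (induction rule: generate.induct)
    case one
    show ?case by (rule trivial'[OF subgroup.one_closed[OF T(1)]])
  next
    case (incl v)
    then show ?case
    proof
      assume "v \<in> {commutator a b | a b. a \<in> B \<and> b \<in> B}"
      then have "v \<in> T" using comm by auto
      then show ?thesis by (rule trivial')
    qed (use pow' in auto)
  next
    case (inv v)
    then show ?case
    proof
      assume "v \<in> {commutator a b | a b. a \<in> B \<and> b \<in> B}"
      then have "inv v \<in> T" using comm subgroup.m_inv_closed[OF T(1)] by auto
      then show ?thesis by (rule trivial')
    next
      assume "v \<in> {b [^] P | b. b \<in> B}"
      then obtain b where b: "b \<in> B" "v = b [^] P" by auto
      then have "inv v = inv b [^] P" using cB nat_pow_inv by simp
      then show ?thesis using b pow' clB(2) by auto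
    qed
  next
    case (eng v w)
    then obtain c d where cd: "c \<in> B" "d \<in> B" "\<phi> v = \<phi> c [^]\<^bsub>?Q\<^esub> P" "\<phi> w = \<phi> d [^]\<^bsub>?Q\<^esub> P"
      by auto
    have "v \<in> B" "w \<in> B" using eng power_comm_subgroup(2)[OF B, of P] by (auto simp: power_comm_def)
    then have "\<phi> (v \<otimes> w) = \<phi> (c \<otimes> d) [^]\<^bsub>?Q\<^esub> P"
      by (simp only: mult cd Q.nat_pow_distrib[OF QC[OF cd(1)] QC[OF cd(2)]])
    then show ?case using clB(1) cd by blast
  qed
  have root: "\<exists>c\<in>B. \<phi> b = \<phi> c [^]\<^bsub>?Q\<^esub> P" if "b \<in> B" for b
  proof -
    have "b \<in> T <#> power_comm P B" using gen that by blast
    then obtain t v where tv: "t \<in> T" "v \<in> power_comm P B" "b = t \<otimes> v"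
      using set_multD by blast
    moreover have "v \<in> B" "t \<in> B" using tv power_comm_subgroup(2)[OF B] T by auto
    ultimately have "\<phi> b = \<phi> v"
      by (simp only: mult trivial Q.l_one[OF QC])
    then show ?thesis using power tv by auto
  qed
  have "\<exists>c\<in>B. \<phi> b = \<phi> c [^]\<^bsub>?Q\<^esub> (P ^ m)" if "b \<in> B" for b m
  proof (induction m)
    case 0
    then show ?case using Q.nat_pow_eone[OF QC[OF that]] that by (metis power_0)
  next
    case (Suc m)
    then obtain c where c: "c \<in> B" "\<phi> b = \<phi> c [^]\<^bsub>?Q\<^esub> (P ^ m)" by auto
    obtain d where d: "d \<in> B" "\<phi> c = \<phi> d [^]\<^bsub>?Q\<^esub> P" using root c by blast
    then show ?case using c Q.nat_pow_pow[OF QC[OF d(1)]] by auto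
  qed
  then have "\<phi> b = \<one>\<^bsub>?Q\<^esub>" if "b \<in> B" for b
    using pow' pow trivial that by metis
  then have "b \<in> T" if "b \<in> B" for b
    using that rcos_self[OF _ T(1), of b] cB by (simp add: \<phi>_def)
  then show ?thesis by blast
qed

text \<open>The induction descends the series. If \<open>B\<close> is \<open>K\<close> times
  \<open>B \<inter> L'\<close>, then \<open>K <#> (B \<inter> L)\<close> is normal in
  \<open>B\<close> and the quotient is the image of \<open>B \<inter> L'\<close>, which is central.
  So the abelian case applies and replaces \<open>L'\<close> by \<open>L\<close>, until
  \<open>L\<close> is trivial.\<close>

lemma subset_of_power_comm:
  assumes cs: "central_series G H k L" and H: "subgroup H G"
    and B: "subgroup B G" "B \<subseteq> H" and K: "subgroup K G" "K \<subseteq> B"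
    and gen: "B \<subseteq> K <#> power_comm P B" and pow: "\<And>b. b \<in> B \<Longrightarrow> b [^] (P ^ n) \<in> K"
    and "B \<subseteq> K <#> (B \<inter> L)"
  shows "B \<subseteq> K"
  using cs assms(9)
proof (induction rule: central_series.induct)
  case trivial
  then show ?case using subgroup.mem_carrier[OF K(1)] by (auto simp: set_mult_def)
next
  case (step k L L' a)
  note cL = central_series_subgroup[OF step(1) H]
  note cB = subgroup.mem_carrier[OF B(1)]
  let ?T = "K <#> (B \<inter> L)"
  have BL: "subgroup (B \<inter> L) G" by (rule subgroups_Inter_pair[OF B(1) cL(1)])
  have T: "subgroup ?T G"
    by (rule subgroup_set_mult[OF K(1) BL normalizes_mono[OF normalizes_Int[OF cL(3) B] K(2)]])
  have TB: "?T \<subseteq> B"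
    unfolding set_mult_def using K(2) by (auto intro!: subgroup.m_closed[OF B(1)])
  have KT: "K \<subseteq> ?T"
  proof
    fix s assume s: "s \<in> K"
    then show "s \<in> ?T"
      using set_multI[OF s subgroup.one_closed[OF BL]] subgroup.mem_carrier[OF K(1) s] by simp
  qed
  have LT: "B \<inter> L \<subseteq> ?T"
  proof
    fix l assume l: "l \<in> B \<inter> L"
    then show "l \<in> ?T"
      using set_multI[OF subgroup.one_closed[OF K(1)] l] cB by simp
  qed
  note clT = subgroup.m_closed[OF T] subgroup.m_inv_closed[OF T]
  note clB = subgroup.m_closed[OF B(1)] subgroup.m_inv_closed[OF B(1)]
  have cLB: "commutator l y \<in> ?T" if "l \<in> B \<inter> L'" "y \<in> B" for l y
  proof -
    have "commutator l y \<in> B" using that clB by simp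
    moreover have "commutator l y \<in> L" using step(7)[of l y] that B by blast
    ultimately show ?thesis using LT by blast
  qed
  have dec: "\<exists>k\<in>K. \<exists>l\<in>B \<inter> L'. b = k \<otimes> l" if "b \<in> B" for b
    using step.prems that by (intro set_multD) blast
  have nT: "normalizes G B ?T" unfolding normalizes_def
  proof (intro ballI)
    fix b t assume bt: "b \<in> B" "t \<in> ?T"
    then obtain k l where kl: "k \<in> K" "l \<in> B \<inter> L'" "b = k \<otimes> l"
      using dec[OF bt(1)] by blast
    have tB: "t \<in> B" and kB: "k \<in> B" using bt TB kl K by blast+
    have "b \<otimes> t \<otimes> inv b = k \<otimes> (commutator l t \<otimes> t) \<otimes> inv k"
      using kl cB tB kB by (simp add: group_word)
    also have "\<dots> \<in> ?T"
      by (intro clT subsetD[OF KT] kl cLB tB bt)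
    finally show "b \<otimes> t \<otimes> inv b \<in> ?T" .
  qed
  \<comment> \<open>The part \<open>k\<close> of \<open>b\<close> lies in the normal subgroup
    \<open>?T\<close>, hence so does its commutator with \<open>y\<close>; the part \<open>l\<close>
    is central modulo \<open>L\<close>.\<close>
  have comm: "commutator b y \<in> ?T" if b: "b \<in> B" and y: "y \<in> B" for b y
  proof -
    obtain k l where kl: "k \<in> K" "l \<in> B \<inter> L'" "b = k \<otimes> l" using dec[OF b] by blast
    have kB: "k \<in> B" and kT: "k \<in> ?T" using KT kl K by blast+
    have "commutator b y = (k \<otimes> commutator l y \<otimes> inv k) \<otimes> (k \<otimes> (y \<otimes> inv k \<otimes> inv y))"
      using kl cB y kB by (simp add: group_word)
    also have "\<dots> \<in> ?T"
      by (intro clT kT cLB kl y normalizesD[OF nT])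
    finally show ?thesis .
  qed
  have "B \<subseteq> ?T"
  proof (rule subset_of_power_comm_abelian[OF B(1) T TB nT comm])
    show "B \<subseteq> ?T <#> power_comm P B" 
      using gen mono_set_mult[OF KT subset_refl] by (rule subset_trans)
    show "b [^] (P ^ n) \<in> ?T" if "b \<in> B" for b using pow[OF that] KT by blast
  qed auto
  then show ?case by (rule step.IH)
qed

text \<open>\<open>A\<close> itself need not be nilpotent. As
  \<open>power_comm P (A \<inter> H)\<close> lies in \<open>H\<close>, the modular law turns the
  factorization of \<open>A\<close> into one of \<open>A \<inter> H\<close>. The nilpotent case puts
  \<open>A \<inter> H\<close> into \<open>K\<close>, and the factorization then puts
  \<open>A\<close> into \<open>K\<close>.\<close>

lemma subset_of_power_comm_Int:
  assumes cs: "central_series G H k H" and H: "subgroup H G"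
    and A: "subgroup A G" and K: "subgroup K G" "K \<subseteq> A"
    and gen: "A \<subseteq> K <#> power_comm P (A \<inter> H)" and pow: "\<And>h. h \<in> H \<Longrightarrow> h [^] (P ^ n) \<in> K"
  shows "A \<subseteq> K"
proof -
  let ?B = "A \<inter> H" and ?K = "K \<inter> H"
  have B: "subgroup ?B G" and K': "subgroup ?K G" by (rule subgroups_Inter_pair; fact)+
  note F = power_comm_subgroup[OF B, of P]
  have dec: "\<exists>k\<in>K. \<exists>v\<in>power_comm P ?B. a = k \<otimes> v" if "a \<in> A" for a
    using that gen by (intro set_multD) blast
  have "?B \<subseteq> ?K <#> power_comm P ?B"
  proof
    fix b assume b: "b \<in> ?B"
    then obtain k v where kv: "k \<in> K" "v \<in> power_comm P ?B" "b = k \<otimes> v" using dec by blast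
    have "v \<in> H" using kv F by blast
    then have "k = b \<otimes> inv v"
      using kv subgroup.mem_carrier[OF K(1)] subgroup.mem_carrier[OF H] by (simp add: group_word)
    then have "k \<in> H" using b \<open>v \<in> H\<close> subgroup.m_closed[OF H] subgroup.m_inv_closed[OF H] by simp
    then show "b \<in> ?K <#> power_comm P ?B" using kv set_multI by simp
  qed
  moreover have "?B \<subseteq> ?K <#> (?B \<inter> H)"
  proof
    fix b assume b: "b \<in> ?B"
    then have "\<one> \<otimes> b \<in> ?K <#> (?B \<inter> H)"
      using subgroup.one_closed[OF K'] by (intro set_multI) auto
    then show "b \<in> ?K <#> (?B \<inter> H)" using b subgroup.mem_carrier[OF H] by simp
  qed
  moreover have "b [^] (P ^ n) \<in> ?K" if "b \<in> ?B" for b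
    using that pow subgroup_nat_pow_closed[OF H, of b] by simp
  ultimately have BK: "?B \<subseteq> ?K"
    using K by (intro subset_of_power_comm[OF cs H B _ K' _ _ _]) auto
  show ?thesis
  proof
    fix a assume "a \<in> A"
    then obtain k v where "k \<in> K" "v \<in> power_comm P ?B" "a = k \<otimes> v" using dec by blast
    then show "a \<in> K" using BK F subgroup.m_closed[OF K(1)] by blast
  qed
qed

end

section \<open>Cyclic factors of subgroups and the uniform bound\<close>

lemma int_subgroup_principal:
  fixes E :: "int set"
  assumes "0 \<in> E" "\<And>s t. s \<in> E \<Longrightarrow> t \<in> E \<Longrightarrow> s - t \<in> E"
  shows "\<exists>d\<in>E. \<forall>t\<in>E. d dvd t"
proof (cases "\<exists>n::nat. n > 0 \<and> int n \<in> E")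
  case False
  have "t = 0" if "t \<in> E" for t
  proof (rule ccontr)
    assume "t \<noteq> 0"
    then have "nat \<bar>t\<bar> > 0 \<and> int (nat \<bar>t\<bar>) \<in> E"
      using that assms(2)[OF assms(1) that] by (auto simp: abs_if)
    then show False using False by blast
  qed
  then show ?thesis using assms(1) by (intro bexI[of _ 0]) auto
next
  case True
  define d where "d = (LEAST n::nat. n > 0 \<and> int n \<in> E)"
  have d: "d > 0" "int d \<in> E" and least: "\<And>n. n > 0 \<Longrightarrow> int n \<in> E \<Longrightarrow> d \<le> n"
    using LeastI_ex[OF True] Least_le[of "\<lambda>n. n > 0 \<and> int n \<in> E"] by (auto simp: d_def)
  have neg: "- s \<in> E" if "s \<in> E" for s using assms(2)[OF assms(1) that] by simp
  have mult: "int d * int n \<in> E" for n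
  proof (induction n)
    case (Suc n)
    then show ?case using assms(2)[OF Suc neg[OF d(2)]] by (simp add: algebra_simps)
  qed (use assms in simp)
  have mult': "int d * z \<in> E" for z
    using mult[of "nat z"] neg[OF mult[of "nat (- z)"]] by (cases "z \<ge> 0") auto
  have "int d dvd t" if t: "t \<in> E" for t
  proof -
    have "t mod int d \<in> E"
      using assms(2)[OF t mult'[of "t div int d"]] by (simp add: minus_mult_div_eq_mod)
    moreover have "0 \<le> t mod int d" "t mod int d < int d" using d(1) by simp_all
    ultimately have "t mod int d = 0" using least[of "nat (t mod int d)"] by force
    then show ?thesis by (simp add: dvd_eq_mod_eq_0)
  qed
  then show ?thesis using d by blast
qed

context group
begin

text \<open>Modulo \<open>L\<close> the base is just \<open>a [^] d\<close>. The corrections are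
  collected on the right by conjugating them with powers of \<open>a\<close>, negative ones
  included, which is why all \<open>a [^] t\<close> must normalize \<open>L\<close>.\<close>

lemma pow_mod_normalized:
  assumes L: "subgroup L G" and "\<And>t::int. normalizes G {a [^] t} L"
    and a: "a \<in> carrier G" and l: "l \<in> L"
  shows "\<exists>l'\<in>L. (a [^] (d::int) \<otimes> l) [^] (s::int) = a [^] (d * s) \<otimes> l'"
proof -
  let ?b = "a [^] d \<otimes> l"
  have lc: "l \<in> carrier G" using l subgroup.mem_carrier[OF L] by auto
  have conj: "a [^] (t::int) \<otimes> m \<otimes> a [^] (- t) \<in> L" if "m \<in> L" for t m
    using assms(2)[of t] that a by (simp add: normalizes_def int_pow_neg)
  have nat: "\<exists>l'\<in>L. ?b [^] n = a [^] (d * int n) \<otimes> l'" for n :: nat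
  proof (induction n)
    case 0
    then show ?case using subgroup.one_closed[OF L] by (intro bexI[of _ \<one>]) auto
  next
    case (Suc n)
    then obtain m where m: "m \<in> L" "?b [^] n = a [^] (d * int n) \<otimes> m" by blast
    have mc: "m \<in> carrier G" using m subgroup.mem_carrier[OF L] by auto
    have e: "d * int (Suc n) = d * int n + d" by (simp add: algebra_simps)
    have "?b [^] Suc n = a [^] (d * int (Suc n)) \<otimes> ((a [^] (- d) \<otimes> m \<otimes> a [^] (- (- d))) \<otimes> l)"
      unfolding e using m mc lc a by (simp add: int_pow_mult int_pow_neg group_word)
    then show ?case using subgroup.m_closed[OF L conj[OF m(1)] l] by blast
  qed
  show ?thesis
  proof (cases s rule: int_cases2)
    case (nonneg n)
    then show ?thesis using nat[of n] by (simp add: int_pow_int)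
  next
    case (nonpos n)
    obtain m where m: "m \<in> L" "?b [^] n = a [^] (d * int n) \<otimes> m" using nat by blast
    have mc: "m \<in> carrier G" using m subgroup.mem_carrier[OF L] by auto
    have "?b [^] s = inv (a [^] (d * int n) \<otimes> m)"
      using nonpos m a lc by (simp add: int_pow_neg_int)
    also have "\<dots> = a [^] (d * s) \<otimes> (a [^] (d * int n) \<otimes> inv m \<otimes> a [^] (- (d * int n)))"
      using nonpos mc a by (simp add: int_pow_neg group_word)
    finally show ?thesis using conj[OF subgroup.m_inv_closed[OF L m(1)]] by blast
  qed
qed

text \<open>The exponents \<open>t\<close> for which the coset of \<open>a [^] t\<close> modulo
  \<open>L\<close> meets \<open>B\<close> form a subgroup of the integers. An element of
  \<open>B\<close> over its generator \<open>d\<close> serves as \<open>b\<close>.\<close>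

lemma cyclic_quotient_subgroup:
  assumes B: "subgroup B G" and L: "subgroup L G"
    and n: "\<And>t::int. normalizes G {a [^] t} L" and a: "a \<in> carrier G"
    and L': "\<And>g. g \<in> L' \<Longrightarrow> \<exists>t::int. \<exists>l\<in>L. g = a [^] t \<otimes> l"
  shows "\<exists>b\<in>B. \<forall>g\<in>B \<inter> L'. \<exists>s::int. \<exists>l\<in>B \<inter> L. g = b [^] s \<otimes> l"
proof -
  define E where "E = {t::int. \<exists>l\<in>L. a [^] t \<otimes> l \<in> B}"
  note clB = subgroup.m_closed[OF B] subgroup.m_inv_closed[OF B]
  note clL = subgroup.m_closed[OF L] subgroup.m_inv_closed[OF L]
  note c = subgroup.mem_carrier[OF B] subgroup.mem_carrier[OF L]
  have conj: "a [^] (t::int) \<otimes> m \<otimes> a [^] (- t) \<in> L" if "m \<in> L" for t m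
    using n[of t] that a by (simp add: normalizes_def int_pow_neg)
  have "0 \<in> E" using subgroup.one_closed[OF B] subgroup.one_closed[OF L]
    by (auto simp: E_def intro!: bexI[of _ \<one>])
  moreover have "s - t \<in> E" if st: "s \<in> E" "t \<in> E" for s t
  proof -
    obtain l m where lm: "l \<in> L" "m \<in> L" "a [^] s \<otimes> l \<in> B" "a [^] t \<otimes> m \<in> B"
      using st unfolding E_def by blast
    have "(a [^] s \<otimes> l) \<otimes> inv (a [^] t \<otimes> m)
        = a [^] (s - t) \<otimes> (a [^] t \<otimes> (l \<otimes> inv m) \<otimes> a [^] (- t))"
      using lm c a by (simp add: int_pow_diff int_pow_neg group_word)
    moreover have "(a [^] s \<otimes> l) \<otimes> inv (a [^] t \<otimes> m) \<in> B" using lm clB by blast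
    moreover have "a [^] t \<otimes> (l \<otimes> inv m) \<otimes> a [^] (- t) \<in> L"
      by (intro conj clL lm)
    ultimately show ?thesis unfolding E_def by auto
  qed
  ultimately obtain d where d: "d \<in> E" "\<And>t. t \<in> E \<Longrightarrow> d dvd t"
    using int_subgroup_principal[of E] by blast
  obtain l0 where l0: "l0 \<in> L" "a [^] d \<otimes> l0 \<in> B" using d by (auto simp: E_def)
  let ?b = "a [^] d \<otimes> l0"
  show ?thesis
  proof (intro bexI[of _ ?b] ballI l0)
    fix g assume g: "g \<in> B \<inter> L'"
    then obtain t l where tl: "l \<in> L" "g = a [^] (t::int) \<otimes> l" using L' by blast
    then have "t \<in> E" using g by (auto simp: E_def)
    then obtain s where s: "t = d * s" using d by (auto elim: dvdE)
    obtain m where m: "m \<in> L" "?b [^] s = a [^] t \<otimes> m"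
      using pow_mod_normalized[OF L n a l0(1), of d s] s by auto
    have cc: "l \<in> carrier G" "m \<in> carrier G" "?b \<in> carrier G" using tl m l0 c by blast+
    have "inv m \<otimes> l = inv (?b [^] s) \<otimes> g"
      using m tl cc a by (simp add: group_word)
    also have "\<dots> \<in> B"
      using g clB subgroup_int_pow_closed[OF B l0(2)] by simp
    finally have "inv m \<otimes> l \<in> B \<inter> L" using clL tl m by simp
    moreover have "g = ?b [^] s \<otimes> (inv m \<otimes> l)"
      using m tl cc a by (simp add: group_word)
    ultimately show "\<exists>s::int. \<exists>l\<in>B \<inter> L. g = ?b [^] s \<otimes> l" by blast
  qed
qed

text \<open>Each cyclic factor of the series contributes at most \<open>P\<close> classes, because
  \<open>b [^] P\<close> is trivial modulo \<open>power_comm P B\<close>. The bound involves the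
  series of \<open>H\<close> only and is the same for all \<open>B\<close>.\<close>

lemma power_comm_cosets_bound:
  assumes cs: "central_series G H k L" and H: "subgroup H G"
    and B: "subgroup B G" "B \<subseteq> H" and P: "P > 0"
  shows "\<exists>C. finite C \<and> C \<subseteq> B \<and> card C \<le> P ^ k \<and>
    (\<forall>b\<in>B \<inter> L. \<exists>c\<in>C. inv c \<otimes> b \<in> power_comm P B)"
  using cs
proof (induction rule: central_series.induct)
  case trivial
  then show ?case
    using subgroup.one_closed[OF B(1)] subgroup.one_closed[OF power_comm_subgroup(1)[OF B(1)]]
    by (intro exI[of _ "{\<one>}"]) auto
next
  case (step k L L' a)
  note cL = central_series_subgroup[OF step(1) H]
  note cB = subgroup.mem_carrier[OF B(1)]
  note clB = subgroup.m_closed[OF B(1)] subgroup.m_inv_closed[OF B(1)]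
  note F = power_comm_subgroup[OF B(1), of P]
  have aH: "a \<in> H" using step by blast
  have "normalizes G {a [^] t} L" for t :: int
    using normalizes_mono[OF cL(3)] subgroup_int_pow_closed[OF H aH] by simp
  then obtain b where b: "b \<in> B"
      and bg: "\<And>g. g \<in> B \<inter> L' \<Longrightarrow> \<exists>s::int. \<exists>l\<in>B \<inter> L. g = b [^] s \<otimes> l"
    using cyclic_quotient_subgroup[OF B(1) cL(1) _ _ step(6)] subgroup.mem_carrier[OF H aH] by metis
  obtain C where C: "finite C" "C \<subseteq> B" "card C \<le> P ^ k"
      "\<And>b. b \<in> B \<inter> L \<Longrightarrow> \<exists>c\<in>C. inv c \<otimes> b \<in> power_comm P B"
    using step.IH by blast
  let ?C = "(\<lambda>(r::nat, c). b [^] r \<otimes> c) ` ({..<P} \<times> C)"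
  have "card ?C \<le> P * card C"
    using card_image_le[of "{..<P} \<times> C" "\<lambda>(r::nat, c). b [^] r \<otimes> c"] C(1)
    by (simp add: card_cartesian_product)
  also have "\<dots> \<le> P ^ Suc k" using C(3) by simp
  finally have card: "card ?C \<le> P ^ Suc k" .
  have "\<exists>c\<in>?C. inv c \<otimes> g \<in> power_comm P B" if g: "g \<in> B \<inter> L'" for g
  proof -
    obtain s l where sl: "l \<in> B \<inter> L" "g = b [^] (s::int) \<otimes> l" using bg[OF g] by blast
    obtain c where c: "c \<in> C" "inv c \<otimes> l \<in> power_comm P B" using C(4)[OF sl(1)] by blast
    \<comment> \<open>Dividing the exponent by \<open>P\<close> leaves a remainder \<open>r\<close>
      below \<open>P\<close>, while \<open>b [^] (q * int P)\<close> is the \<open>P\<close>-th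
      power of \<open>b [^] q\<close>.\<close>
    define r q where "r = nat (s mod int P)" and "q = s div int P"
    have s: "s = int r + q * int P" and r: "r < P"
      using P by (auto simp: r_def q_def nat_less_iff)
    have bq: "b [^] q \<in> B" using subgroup_int_pow_closed[OF B(1) b] .
    have bP: "b [^] (q * int P) \<in> power_comm P B"
      using power_comm_pow[OF bq, of P] int_pow_pow[OF cB[OF b], of q "int P"] by (simp add: int_pow_int)
    have cc: "c \<in> carrier G" "l \<in> carrier G" "b \<in> carrier G" "c \<in> B" using c C sl cB b by blast+
    have "inv (b [^] r \<otimes> c) \<otimes> g = (inv c \<otimes> b [^] (q * int P) \<otimes> c) \<otimes> (inv c \<otimes> l)"
      using cc sl by (simp add: s int_pow_mult int_pow_int group_word)
    also have "\<dots> \<in> power_comm P B"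
      by (rule subgroup.m_closed[OF F(1) normalizesD'[OF F(3) B(1) cc(4) bP] c(2)])
    finally have "inv (b [^] r \<otimes> c) \<otimes> g \<in> power_comm P B" .
    then show ?thesis using r c by force
  qed
  moreover have "?C \<subseteq> B"
    using C(2) subgroup_nat_pow_closed[OF B(1) b] clB(1) by auto
  ultimately show ?case using card C(1) by (intro exI[of _ ?C] conjI ballI) auto
qed

text \<open>The subgroups \<open>A j = (\<Union>l. K l j)\<close> have quotients \<open>A j / N j (power_comm P (A j \<inter> H))\<close> of
  bounded order. A set of representatives at a level \<open>J\<close> where this order is maximal lies in a
  single \<open>K l J\<close> and lifts to representatives at every later level, so \<open>K l j\<close> surjects onto the
  quotient and hence equals \<open>A j\<close>.\<close>
theorem double_chain_stabilizes:
  fixes N :: "nat \<Rightarrow> 'a set" and K :: "nat \<Rightarrow> nat \<Rightarrow> 'a set"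
    and P :: nat
  assumes cs: "central_series G H k H" and H: "subgroup H G" and fin: "finite (rcosets H)"
    and P: "P > 0" and N: "\<And>j. subgroup (N j) G" "\<And>j. normalizes G (carrier G) (N j)" "antimono N"
    and pow: "\<And>j. \<exists>n. \<forall>h\<in>H. h [^] (P ^ n) \<in> N j"
    and K: "\<And>l j. subgroup (K l j) G" "\<And>l j. N j \<subseteq> K l j"
    and mono: "\<And>j. mono (\<lambda>l. K l j)" and anti: "\<And>l. antimono (K l)"
    and lift: "\<And>l i j g. i \<le> j \<Longrightarrow> g \<in> K l i \<Longrightarrow> \<exists>g'\<in>K l j. inv g \<otimes> g' \<in> N i"
  shows "\<exists>l J. \<forall>j\<ge>J. \<forall>l'. K l' j \<subseteq> K l j"
proof -
  define A where "A j = (\<Union>l. K l j)" for j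
  define F where "F j = power_comm P (A j \<inter> H) <#> N j" for j
  note cK = subgroup.mem_carrier[OF K(1)]
  have A: "subgroup (A j) G" for j
  proof
    show "A j \<subseteq> carrier G" using cK by (auto simp: A_def)
    show "\<one> \<in> A j" using subgroup.one_closed[OF K(1)] by (auto simp: A_def)
    show "inv x \<in> A j" if "x \<in> A j" for x
      using that subgroup.m_inv_closed[OF K(1)] by (auto simp: A_def)
    show "x \<otimes> y \<in> A j" if xy: "x \<in> A j" "y \<in> A j" for x y
    proof -
      obtain l l' where l: "x \<in> K l j" "y \<in> K l' j" using xy by (auto simp: A_def)
      then have "x \<in> K (max l l') j" "y \<in> K (max l l') j"
        using monoD[OF mono, of l "max l l'" j] monoD[OF mono, of l' "max l l'" j] by auto
      then have "x \<otimes> y \<in> K (max l l') j" by (rule subgroup.m_closed[OF K(1)])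
      then show ?thesis by (auto simp: A_def)
    qed
  qed
  note cA = subgroup.mem_carrier[OF A]
  have B: "subgroup (A j \<inter> H) G" for j by (rule subgroups_Inter_pair[OF A H])
  note PC = power_comm_subgroup[OF B]
  have F: "subgroup (F j) G" for j
    unfolding F_def
    by (rule subgroup_set_mult[OF PC(1) N(1) normalizes_mono[OF N(2) subgroup.subset[OF PC(1)]]])
  have NF: "N j \<subseteq> F j" for j
  proof
    fix x assume x: "x \<in> N j"
    then show "x \<in> F j"
      using set_multI[OF subgroup.one_closed[OF PC(1)] x] subgroup.mem_carrier[OF N(1) x]
      by (simp add: F_def)
  qed
  have PF: "power_comm P (A j \<inter> H) \<subseteq> F j" for j
  proof
    fix x assume x: "x \<in> power_comm P (A j \<inter> H)"
    then show "x \<in> F j"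
      using set_multI[OF x subgroup.one_closed[OF N(1)]] subgroup.mem_carrier[OF PC(1) x]
      by (simp add: F_def)
  qed
  have A_anti: "A j \<subseteq> A i" if "i \<le> j" for i j
    using antimonoD[OF anti that] by (auto simp: A_def)
  have F_anti: "F j \<subseteq> F i" if "i \<le> j" for i j
    unfolding F_def
    using antimonoD[OF N(3) that] power_comm_mono[of "A j \<inter> H" "A i \<inter> H" P] A_anti[OF that]
    by (intro mono_set_mult) auto
  \<comment> \<open>Finite sets of elements pairwise inequivalent modulo \<open>F j\<close>: their
    sizes stand in for the order of the quotient.\<close>
  define ind where "ind j T \<longleftrightarrow> finite T \<and> T \<subseteq> A j \<and> (\<forall>s\<in>T. \<forall>t\<in>T. inv s \<otimes> t \<in> F j \<longrightarrow> s = t)" for j T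
  have bound: "card T \<le> card (rcosets H) * P ^ k" if T: "ind j T" for j T
  proof -
    have T: "finite T" "T \<subseteq> A j" "\<And>s t. s \<in> T \<Longrightarrow> t \<in> T \<Longrightarrow> inv s \<otimes> t \<in> F j \<Longrightarrow> s = t"
      using T by (auto simp: ind_def)
    obtain C where C: "finite C" "C \<subseteq> A j \<inter> H" "card C \<le> P ^ k"
      "\<And>b. b \<in> A j \<inter> H \<Longrightarrow> \<exists>c\<in>C. inv c \<otimes> b \<in> power_comm P (A j \<inter> H)"
      using power_comm_cosets_bound[OF cs H B Int_lower2 P, of j, unfolded Int_assoc Int_absorb]
      by (elim exE conjE) blast
    \<comment> \<open>Left cosets \<open>t H\<close> are recorded as right cosets
      \<open>H #> inv t\<close>. Then \<open>t\<close> is the chosen representative times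
      \<open>q t\<close>, with \<open>q t\<close> in \<open>A j \<inter> H\<close>, and modulo
      \<open>F j\<close> it is determined by its coset and the class of \<open>q t\<close>.\<close>
    define rep where "rep D = (SOME a. a \<in> A j \<and> D = H #> inv a)" for D
    have rep: "rep (H #> inv t) \<in> A j" "H #> inv (rep (H #> inv t)) = H #> inv t"
      if t: "t \<in> A j" for t
    proof -
      have "rep (H #> inv t) \<in> A j \<and> H #> inv t = H #> inv (rep (H #> inv t))"
        unfolding rep_def by (rule someI[of "\<lambda>a. a \<in> A j \<and> H #> inv t = H #> inv a" t]) (simp add: t)
      then show "rep (H #> inv t) \<in> A j" "H #> inv (rep (H #> inv t)) = H #> inv t" by auto
    qed
    define q where "q t = inv (rep (H #> inv t)) \<otimes> t" for t
    have q: "q t \<in> A j \<inter> H" if t: "t \<in> A j" for t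
    proof -
      let ?r = "rep (H #> inv t)"
      have c: "?r \<in> carrier G" "t \<in> carrier G" using rep t cA by blast+
      have "inv ?r \<in> H #> inv t" using rep(2)[OF t] rcos_self[OF _ H, of "inv ?r"] c by simp
      then obtain h where h: "h \<in> H" "inv ?r = h \<otimes> inv t" by (auto simp: r_coset_def)
      then have "q t = h" using c subgroup.mem_carrier[OF H] by (simp add: q_def group_word)
      moreover have "q t \<in> A j"
        unfolding q_def by (intro subgroup.m_closed[OF A] subgroup.m_inv_closed[OF A] rep(1) t)
      ultimately show ?thesis using h by simp
    qed
    obtain c where c: "\<And>t. t \<in> A j \<Longrightarrow> c t \<in> C \<and> inv (c t) \<otimes> q t \<in> power_comm P (A j \<inter> H)"
      using C(4)[OF q] by metis
    have "inj_on (\<lambda>t. (H #> inv t, c t)) T"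
    proof (rule inj_onI)
      fix s t assume st: "s \<in> T" "t \<in> T" and e: "(H #> inv s, c s) = (H #> inv t, c t)"
      have a: "s \<in> A j" "t \<in> A j" using st T by auto
      let ?r = "rep (H #> inv t)"
      have r: "rep (H #> inv s) = ?r" using e by simp
      have cc: "s \<in> carrier G" "t \<in> carrier G" "?r \<in> carrier G" "c t \<in> carrier G"
        using a rep c C cA by blast+
      have "inv (inv (c t) \<otimes> q s) \<otimes> (inv (c t) \<otimes> q t) \<in> power_comm P (A j \<inter> H)"
        using subgroup.m_closed[OF PC(1) subgroup.m_inv_closed[OF PC(1)]] c[OF a(1)] c[OF a(2)] e
        by (metis prod.inject)
      moreover have "inv (inv (c t) \<otimes> q s) \<otimes> (inv (c t) \<otimes> q t) = inv s \<otimes> t"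
        using cc by (simp add: q_def r group_word)
      ultimately show "s = t" using T(3) st PF by auto
    qed
    moreover have "(\<lambda>t. (H #> inv t, c t)) ` T \<subseteq> (rcosets H) \<times> C"
      using T(2) c cA subgroup.subset[OF H] by (auto intro!: rcosetsI)
    ultimately have "card T \<le> card ((rcosets H) \<times> C)"
      using fin C(1) by (intro card_inj_on_le[of _ T]) auto
    also have "\<dots> \<le> card (rcosets H) * P ^ k" using C(3) by (simp add: card_cartesian_product)
    finally show ?thesis .
  qed
  let ?Q = "\<lambda>n. \<exists>j T. ind j T \<and> card T = n"
  have "?Q 0" by (intro exI[of _ 0] exI[of _ "{}"]) (simp add: ind_def)
  moreover have "\<And>n. ?Q n \<Longrightarrow> n \<le> card (rcosets H) * P ^ k" using bound by blast
  ultimately have "\<exists>n. ?Q n \<and> (\<forall>m. ?Q m \<longrightarrow> m \<le> n)"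
    using Nat.ex_has_greatest_nat[of ?Q 0 "card (rcosets H) * P ^ k"] by blast
  then obtain J T where T: "ind J T" and max: "\<And>j S. ind j S \<Longrightarrow> card S \<le> card T" by blast
  have "\<exists>l. T \<subseteq> K l J"
  proof -
    have "finite T" "T \<subseteq> (\<Union>l. K l J)" using T by (auto simp: ind_def A_def)
    then show ?thesis
    proof (induction T rule: finite_induct)
      case (insert t T)
      then obtain l l' where "T \<subseteq> K l J" "t \<in> K l' J" by auto
      then have "insert t T \<subseteq> K (max l l') J"
        using monoD[OF mono, of l "max l l'" J] monoD[OF mono, of l' "max l l'" J] by auto
      then show ?case by blast
    qed simp
  qed
  then obtain l where l: "T \<subseteq> K l J" by blast
  have "A j \<subseteq> K l j" if j: "J \<le> j" for j
  proof -
    have "\<exists>g'. g' \<in> K l j \<and> inv g \<otimes> g' \<in> N J" if "g \<in> T" for g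
      using lift[OF j] l that by blast
    then obtain \<tau> where \<tau>: "\<And>t. t \<in> T \<Longrightarrow> \<tau> t \<in> K l j \<and> inv t \<otimes> \<tau> t \<in> N J" by metis
    have TA: "T \<subseteq> A J" and fT: "finite T" using T by (auto simp: ind_def)
    \<comment> \<open>Each \<open>\<tau> t\<close> differs from \<open>t\<close> by an element of
      \<open>N J\<close>, which lies in \<open>F J\<close>. The lifts are thus inequivalent modulo
      \<open>F J\<close>, and a fortiori modulo the smaller \<open>F j\<close>.\<close>
    have sep: "s = t" if st: "s \<in> T" "t \<in> T" and e: "inv (\<tau> s) \<otimes> \<tau> t \<in> F J" for s t
    proof -
      have c: "s \<in> carrier G" "t \<in> carrier G" "\<tau> s \<in> carrier G" "\<tau> t \<in> carrier G"
        using st \<tau> TA cA cK by blast+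
      have "inv s \<otimes> t = (inv s \<otimes> \<tau> s) \<otimes> (inv (\<tau> s) \<otimes> \<tau> t) \<otimes> inv (inv t \<otimes> \<tau> t)"
        using c by (simp add: group_word)
      also have "\<dots> \<in> F J"
        using subgroup.m_closed[OF F subgroup.m_closed[OF F _ e] subgroup.m_inv_closed[OF F]]
          subsetD[OF NF] \<tau> st(1,2) by blast
      finally show ?thesis using T st by (auto simp: ind_def)
    qed
    have inj: "inj_on \<tau> T"
    proof (rule inj_onI)
      fix s t assume st: "s \<in> T" "t \<in> T" "\<tau> s = \<tau> t"
      then show "s = t" using sep[of s t] subgroup.one_closed[OF F] \<tau> cK l_inv by metis
    qed
    have ind: "ind j (\<tau> ` T)"
      unfolding ind_def
    proof (intro conjI ballI impI)
      show "\<tau> ` T \<subseteq> A j" using \<tau> by (auto simp: A_def)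
      fix x y assume "x \<in> \<tau> ` T" "y \<in> \<tau> ` T" "inv x \<otimes> y \<in> F j"
      then show "x = y" using sep F_anti[OF j] by blast
    qed (use fT in simp)
    show ?thesis
    proof (rule subset_of_power_comm_Int[OF cs H A K(1)])
      show "K l j \<subseteq> A j" by (auto simp: A_def)
      show "\<And>h. h \<in> H \<Longrightarrow> h [^] (P ^ (SOME n. \<forall>h\<in>H. h [^] (P ^ n) \<in> N j)) \<in> K l j"
        using someI_ex[OF pow[of j]] K(2) by blast
      show "A j \<subseteq> K l j <#> power_comm P (A j \<inter> H)"
      proof
        fix a assume a: "a \<in> A j"
        \<comment> \<open>Otherwise \<open>a\<close> could be added to the lifts, giving an
          inequivalent set larger than the maximal \<open>T\<close>.\<close>
        have "\<exists>t\<in>T. inv (\<tau> t) \<otimes> a \<in> F j"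
        proof (rule ccontr)
          assume no: "\<not> (\<exists>t\<in>T. inv (\<tau> t) \<otimes> a \<in> F j)"
          have no': "inv a \<otimes> \<tau> t \<notin> F j" if "t \<in> T" for t
          proof
            assume "inv a \<otimes> \<tau> t \<in> F j"
            then have "inv (inv a \<otimes> \<tau> t) \<in> F j" by (rule subgroup.m_inv_closed[OF F])
            moreover have "\<tau> t \<in> carrier G" using \<tau>[OF that] cK by blast
            then have "inv (inv a \<otimes> \<tau> t) = inv (\<tau> t) \<otimes> a"
              using cA[OF a] by (simp add: group_word)
            ultimately show False using no that by auto
          qed
          have "a \<notin> \<tau> ` T"
            using no' subgroup.one_closed[OF F] l_inv[OF cA[OF a]] by (metis imageE)
          moreover have "ind j (insert a (\<tau> ` T))"
            using ind a no no' unfolding ind_def by auto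
          ultimately show False
            using max[of j "insert a (\<tau> ` T)"] fT card_image[OF inj] by simp
        qed
        then obtain t where t: "t \<in> T" "inv (\<tau> t) \<otimes> a \<in> F j" by blast
        then obtain u v where uv: "u \<in> N j" "v \<in> power_comm P (A j \<inter> H)" "inv (\<tau> t) \<otimes> a = v \<otimes> u"
          using set_multD unfolding F_def by blast
        have c: "\<tau> t \<in> carrier G" "u \<in> carrier G" "v \<in> carrier G"
          using \<tau>[OF t(1)] cK subgroup.mem_carrier[OF N(1) uv(1)] subgroup.mem_carrier[OF PC(1) uv(2)]
          by auto
        have "a = \<tau> t \<otimes> (inv (\<tau> t) \<otimes> a)" using c cA[OF a] by simp
        \<comment> \<open>Conjugating \<open>u\<close> past \<open>v\<close> keeps it in the normal
          subgroup \<open>N j\<close>, where it is absorbed by \<open>K l j\<close>.\<close>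
        also have "\<dots> = (\<tau> t \<otimes> (v \<otimes> u \<otimes> inv v)) \<otimes> v" using uv c by (simp add: group_word)
        also have "\<dots> \<in> K l j <#> power_comm P (A j \<inter> H)"
          by (rule set_multI[OF subgroup.m_closed[OF K(1) conjunct1[OF \<tau>[OF t(1)]]
                subsetD[OF K(2) normalizesD[OF N(2) c(3) uv(1)]]] uv(2)])
        finally show "a \<in> K l j <#> power_comm P (A j \<inter> H)" .
      qed
    qed
  qed
  then show ?thesis by (intro exI[of _ l] exI[of _ J]) (auto simp: A_def)
qed

end

section \<open>Cantor actions\<close>

locale adapted_cantor_action = group G for G :: "('g, 'b) monoid_scheme" (structure) +
  fixes \<Phi> :: "'g \<Rightarrow> 'x::metric_space \<Rightarrow> 'x" and x :: 'x and U :: "nat \<Rightarrow> 'x set"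
  assumes action: "cantor_action G \<Phi>" and basis: "adapted_basis G \<Phi> x U"
begin

lemma compact_space: "compact (UNIV :: 'x set)"
  using action by (simp add: cantor_action_def cantor_space_def)

lemma act_mult: "g \<in> carrier G \<Longrightarrow> h \<in> carrier G \<Longrightarrow> \<Phi> (g \<otimes> h) y = \<Phi> g (\<Phi> h y)"
  using action by (simp add: cantor_action_def homeo_action_def)

lemma act_one: "\<Phi> \<one> y = y"
  using action by (simp add: cantor_action_def homeo_action_def)

lemma act_inv:
  "g \<in> carrier G \<Longrightarrow> \<Phi> (inv g) (\<Phi> g y) = y" "g \<in> carrier G \<Longrightarrow> \<Phi> g (\<Phi> (inv g) y) = y"
  by (simp_all add: act_one flip: act_mult)

lemma act_homeo: "g \<in> carrier G \<Longrightarrow> \<exists>h. homeomorphism UNIV UNIV (\<Phi> g) h"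
  using action by (simp add: cantor_action_def homeo_action_def)

lemma act_continuous: "g \<in> carrier G \<Longrightarrow> continuous_on UNIV (\<Phi> g)"
  using act_homeo homeomorphism_cont1 by blast

lemma equicontinuous:
  assumes "e > 0"
  obtains d where "d > 0" "\<And>g y z. g \<in> carrier G \<Longrightarrow> dist y z < d \<Longrightarrow> dist (\<Phi> g y) (\<Phi> g z) < e"
  using action assms by (auto simp: cantor_action_def equicontinuous_action_def)

lemma orbit_meets_open:
  assumes "open V" "V \<noteq> {}"
  shows "\<exists>g\<in>carrier G. \<Phi> g y \<in> V"
proof -
  have "closure ((\<lambda>g. \<Phi> g y) ` carrier G) = UNIV"
    using action by (simp add: cantor_action_def minimal_action_def)
  then have "V \<inter> (\<lambda>g. \<Phi> g y) ` carrier G \<noteq> {}"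
    using open_Int_closure_eq_empty[OF assms(1)] assms(2) by auto
  then show ?thesis by auto
qed

section \<open>The partitions into translates of \<open>U j\<close>\<close>

lemma U_adapted: "adapted G \<Phi> (U j)"
  using basis by (simp add: adapted_basis_def)

lemma U_open: "open (U j)" and U_closed: "closed (U j)" and U_nonempty: "U j \<noteq> {}"
  using U_adapted[of j] by (auto simp: adapted_def clopen_set_def)

lemma U_antimono: "i \<le> j \<Longrightarrow> U j \<subseteq> U i"
  by (rule lift_Suc_antimono_le[of U]) (use basis in \<open>simp_all add: adapted_basis_def psubset_imp_subset\<close>)

lemma x_in_U: "x \<in> U j"
proof -
  have "x \<in> (\<Inter>l. U l)" using basis by (simp add: adapted_basis_def)
  then show ?thesis by blast
qed

lemma U_invariant:
  assumes "g \<in> carrier G" "y \<in> U j" "\<Phi> g y \<in> U j"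
  shows "\<Phi> g ` U j = U j"
  using U_adapted[of j] assms by (auto simp: adapted_def)

text \<open>Both points lie in the translate of \<open>U j\<close> by \<open>inv g\<close>.
  Adaptedness makes the translates a partition into clopen sets, of which these are the
  classes.\<close>

definition rel :: "nat \<Rightarrow> 'x \<Rightarrow> 'x \<Rightarrow> bool" where
  "rel j y z \<longleftrightarrow> (\<exists>g\<in>carrier G. \<Phi> g y \<in> U j \<and> \<Phi> g z \<in> U j)"

lemma rel_refl: "rel j y y"
  using orbit_meets_open[OF U_open U_nonempty] by (auto simp: rel_def)

lemma rel_sym: "rel j y z \<Longrightarrow> rel j z y"
  by (auto simp: rel_def)

text \<open>The element \<open>h \<otimes> inv g\<close> takes a point of \<open>U j\<close> into
  \<open>U j\<close>, hence preserves \<open>U j\<close> by adaptedness. Transitivity of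
  \<open>rel j\<close> rests on this.\<close>

lemma rel_mem:
  assumes "rel j y z" "h \<in> carrier G" "\<Phi> h y \<in> U j"
  shows "\<Phi> h z \<in> U j"
proof -
  obtain g where g: "g \<in> carrier G" "\<Phi> g y \<in> U j" "\<Phi> g z \<in> U j"
    using assms(1) by (auto simp: rel_def)
  have e: "\<Phi> (h \<otimes> inv g) (\<Phi> g w) = \<Phi> h w" for w
    using g assms by (simp add: act_mult act_inv)
  have "\<Phi> (h \<otimes> inv g) ` U j = U j"
    by (rule U_invariant[of _ "\<Phi> g y"]) (use g assms e in auto)
  then show ?thesis using g(3) e[of z] by (metis image_eqI)
qed

lemma rel_trans: "rel j y z \<Longrightarrow> rel j z w \<Longrightarrow> rel j y w"
  using rel_mem unfolding rel_def by blast

lemma rel_act: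
  assumes "rel j y z" "h \<in> carrier G"
  shows "rel j (\<Phi> h y) (\<Phi> h z)"
proof -
  obtain g where g: "g \<in> carrier G" "\<Phi> g y \<in> U j" "\<Phi> g z \<in> U j"
    using assms(1) by (auto simp: rel_def)
  then show ?thesis
    unfolding rel_def using assms by (intro bexI[of _ "g \<otimes> inv h"]) (simp_all add: act_mult act_inv)
qed

lemma rel_antimono: "i \<le> j \<Longrightarrow> rel j y z \<Longrightarrow> rel i y z"
  unfolding rel_def using U_antimono by blast

lemma translates_open: "g \<in> carrier G \<Longrightarrow> open {y. \<Phi> g y \<in> U j}"
  using open_vimage[OF U_open act_continuous, of g j] by (simp add: vimage_def)

lemma rel_Lebesgue:
  obtains d where "d > 0" "\<And>T. diameter T < d \<Longrightarrow> \<exists>g\<in>carrier G. \<forall>y\<in>T. \<Phi> g y \<in> U j"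
proof -
  let ?C = "(\<lambda>g. {y. \<Phi> g y \<in> U j}) ` carrier G"
  have cover: "UNIV \<subseteq> \<Union>?C" using orbit_meets_open[OF U_open U_nonempty] by blast
  have ne: "?C \<noteq> {}" using one_closed by blast
  have op: "\<And>B. B \<in> ?C \<Longrightarrow> open B" using translates_open by auto
  show thesis
  proof (rule Lebesgue_number_lemma[OF compact_space ne cover op])
    fix d assume "0 < d" and d: "\<And>T. T \<subseteq> UNIV \<Longrightarrow> diameter T < d \<Longrightarrow> \<exists>B\<in>?C. T \<subseteq> B"
    have "\<exists>g\<in>carrier G. \<forall>y\<in>T. \<Phi> g y \<in> U j" if "diameter T < d" for T
      using d[OF subset_UNIV that] by auto
    with \<open>0 < d\<close> show thesis by (rule that)
  qed
qed

lemma rel_of_dist: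
  obtains d where "d > 0" "\<And>y z. dist y z < d \<Longrightarrow> rel j y z"
proof -
  obtain d where d: "d > 0" "\<And>T. diameter T < d \<Longrightarrow> \<exists>g\<in>carrier G. \<forall>y\<in>T. \<Phi> g y \<in> U j"
    using rel_Lebesgue[of j] by blast
  have "rel j y z" if "dist y z < d" for y z
  proof -
    have "diameter {y, z} \<le> dist y z"
      by (simp add: diameter_def) (rule cSup_least, auto simp: dist_commute)
    then show ?thesis using d(2)[of "{y, z}"] that by (auto simp: rel_def)
  qed
  then show thesis using d(1) that by blast
qed

lemma U_small:
  assumes "r > 0"
  shows "\<exists>l. U l \<subseteq> ball x r"
proof -
  have "- ball x r \<subseteq> (\<Union>l. - U l)"
  proof
    fix y assume "y \<in> - ball x r"
    then have "y \<notin> (\<Inter>l. U l)" using basis assms by (auto simp: adapted_basis_def)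
    then show "y \<in> (\<Union>l. - U l)" by blast
  qed
  note cover = this
  have "compact (- ball x r)"
    using compact_Int_closed[OF compact_space closed_Compl[OF open_ball[of x r]]] by simp
  then obtain L where "L \<subseteq> UNIV" and L: "finite L" "- ball x r \<subseteq> (\<Union>l\<in>L. - U l)"
    by (rule compactE_image[OF _ open_Compl[OF U_closed] cover])
  \<comment> \<open>The sets decrease, so the largest index of the finite subcover suffices;
    inserting 0 handles an empty \<open>L\<close>.\<close>
  have "U (Max (insert 0 L)) \<subseteq> U l" if "l \<in> L" for l
    using that L(1) by (intro U_antimono) auto
  then have "U (Max (insert 0 L)) \<subseteq> ball x r" using L(2) by blast
  then show ?thesis ..
qed

text \<open>Equicontinuity keeps all translates of a small \<open>U j\<close> uniformly small. With
  \<open>rel_of_dist\<close>, uniform closeness of maps can be tested on the partitions.\<close>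

lemma dist_of_rel:
  assumes "e > 0"
  shows "\<exists>J. \<forall>j\<ge>J. \<forall>y z. rel j y z \<longrightarrow> dist y z < e"
proof -
  obtain d where d: "d > 0"
      "\<And>g y z. g \<in> carrier G \<Longrightarrow> dist y z < d \<Longrightarrow> dist (\<Phi> g y) (\<Phi> g z) < e"
    using equicontinuous[OF assms] by blast
  obtain J where J: "U J \<subseteq> ball x (d / 2)" using U_small[of "d / 2"] d by auto
  have "dist y z < e" if j: "j \<ge> J" and yz: "rel j y z" for j y z
  proof -
    obtain g where g: "g \<in> carrier G" "\<Phi> g y \<in> U j" "\<Phi> g z \<in> U j"
      using yz by (auto simp: rel_def)
    then have "\<Phi> g y \<in> ball x (d / 2)" "\<Phi> g z \<in> ball x (d / 2)"
      using J U_antimono[OF j] by blast+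
    then have "dist (\<Phi> g y) (\<Phi> g z) < d"
      using dist_triangle_half_r[of x "\<Phi> g y" d "\<Phi> g z"] by simp
    from d(2)[OF inv_closed[OF g(1)] this] show ?thesis using g by (simp add: act_inv)
  qed
  then show ?thesis by blast
qed

section \<open>The Ellis group and its images at finite levels\<close>

abbreviation E :: "('x \<Rightarrow> 'x) set" where "E \<equiv> ellis_closure G \<Phi>"

lemma E_approx: "f \<in> E \<Longrightarrow> e > 0 \<Longrightarrow> \<exists>g\<in>carrier G. \<forall>y. dist (f y) (\<Phi> g y) < e"
  by (simp add: ellis_closure_def)

lemma E_act: "g \<in> carrier G \<Longrightarrow> \<Phi> g \<in> E"
  using act_homeo unfolding ellis_closure_def by (auto intro!: bexI[of _ g])

lemma E_id: "(\<lambda>y. y) \<in> E"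
proof -
  have "\<Phi> \<one> = (\<lambda>y. y)" using act_one by auto
  then show ?thesis using E_act[OF one_closed] by simp
qed

lemma E_comp:
  assumes "f \<in> E" "f' \<in> E"
  shows "(\<lambda>y. f (f' y)) \<in> E"
proof -
  obtain h h' where "homeomorphism UNIV UNIV f h" "homeomorphism UNIV UNIV f' h'"
    using assms by (auto simp: ellis_closure_def)
  then have "homeomorphism UNIV UNIV (f \<circ> f') (h' \<circ> h)" using homeomorphism_compose by blast
  then have "\<exists>h. homeomorphism UNIV UNIV (\<lambda>y. f (f' y)) h" by (auto simp: comp_def)
  moreover have "\<exists>g\<in>carrier G. \<forall>y. dist (f (f' y)) (\<Phi> g y) < e" if e: "e > 0" for e
  proof -
    obtain d where d: "d > 0"
        "\<And>g y z. g \<in> carrier G \<Longrightarrow> dist y z < d \<Longrightarrow> dist (\<Phi> g y) (\<Phi> g z) < e / 2"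
      using equicontinuous[OF half_gt_zero[OF e]] by blast
    obtain g where g: "g \<in> carrier G" "\<And>y. dist (f y) (\<Phi> g y) < e / 2"
      using E_approx[OF assms(1), of "e / 2"] e by auto
    obtain g' where g': "g' \<in> carrier G" "\<And>y. dist (f' y) (\<Phi> g' y) < d"
      using E_approx[OF assms(2) d(1)] by auto
    have "dist (f (f' y)) (\<Phi> (g \<otimes> g') y) < e" for y
    proof -
      have "dist (f (f' y)) (\<Phi> g (f' y)) < e / 2" by (rule g)
      moreover have "dist (\<Phi> g (f' y)) (\<Phi> (g \<otimes> g') y) < e / 2"
        using d(2)[OF g(1) g'(2)] g g' by (simp add: act_mult)
      ultimately show ?thesis
        using dist_triangle[of "f (f' y)" "\<Phi> (g \<otimes> g') y" "\<Phi> g (f' y)"] by linarith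
    qed
    then show ?thesis using m_closed[OF g(1) g'(1)] by blast
  qed
  ultimately show ?thesis by (simp add: ellis_closure_def)
qed

lemma E_inverse:
  assumes "f \<in> E"
  obtains h where "h \<in> E" "\<And>y. h (f y) = y" "\<And>y. f (h y) = y"
proof -
  obtain h where h: "homeomorphism UNIV UNIV f h"
    using assms by (auto simp: ellis_closure_def)
  have hf: "h (f y) = y" and fh: "f (h y) = y" for y
    using homeomorphism_apply1[OF h] homeomorphism_apply2[OF h] by auto
  have "\<exists>g\<in>carrier G. \<forall>y. dist (h y) (\<Phi> g y) < e" if e: "e > 0" for e
  proof -
    obtain d where d: "d > 0"
        "\<And>g y z. g \<in> carrier G \<Longrightarrow> dist y z < d \<Longrightarrow> dist (\<Phi> g y) (\<Phi> g z) < e"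
      using equicontinuous[OF e] by blast
    obtain g where g: "g \<in> carrier G" "\<And>y. dist (f y) (\<Phi> g y) < d"
      using E_approx[OF assms d(1)] by auto
    \<comment> \<open>Apply \<open>inv g\<close> to the nearby points \<open>y = f (h y)\<close> and
      \<open>\<Phi> g (h y)\<close>; equicontinuity is uniform in the group element.\<close>
    have "dist (h y) (\<Phi> (inv g) y) < e" for y
      using d(2)[OF inv_closed[OF g(1)] g(2)[of "h y"]] g(1)
      by (simp add: act_inv fh dist_commute)
    then show ?thesis using g(1) by blast
  qed
  then have "h \<in> E" using homeomorphism_symD[OF h] by (auto simp: ellis_closure_def)
  then show thesis using that hf fh by blast
qed

text \<open>Points closer than a Lebesgue number share a translate of \<open>U j\<close>. So an
  element of the Ellis group acts on the translates as some element of \<open>G\<close>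
  does.\<close>

lemma E_rel_approx: "f \<in> E \<Longrightarrow> \<exists>g\<in>carrier G. \<forall>y. rel j (f y) (\<Phi> g y)"
proof -
  assume f: "f \<in> E"
  obtain d where d: "d > 0" "\<And>y z. dist y z < d \<Longrightarrow> rel j y z"
    using rel_of_dist[of j] by blast
  then show ?thesis using E_approx[OF f d(1)] by blast
qed

text \<open>The image in \<open>G\<close> of the pointwise stabilizer of \<open>U l\<close> in the Ellis group, modulo the
  kernel of the action on the translates of \<open>U j\<close>.\<close>
definition K :: "nat \<Rightarrow> nat \<Rightarrow> 'g set" where
  "K l j = {g \<in> carrier G. \<exists>f\<in>E. (\<forall>y\<in>U l. f y = y) \<and> (\<forall>y. rel j (f y) (\<Phi> g y))}"

definition N :: "nat \<Rightarrow> 'g set" where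
  "N j = {g \<in> carrier G. \<forall>y. rel j (\<Phi> g y) y}"

lemma N_subgroup: "subgroup (N j) G"
proof
  show "g \<otimes> h \<in> N j" if "g \<in> N j" "h \<in> N j" for g h
    using that rel_trans[of j "\<Phi> g (\<Phi> h y)" "\<Phi> h y" y for y] by (auto simp: N_def act_mult)
  show "inv g \<in> N j" if "g \<in> N j" for g
  proof -
    have g: "g \<in> carrier G" "\<And>y. rel j (\<Phi> g y) y" using that by (auto simp: N_def)
    have "rel j (\<Phi> (inv g) y) y" for y
      using rel_sym[OF g(2)[of "\<Phi> (inv g) y"]] g(1) by (simp add: act_inv)
    then show ?thesis using g by (simp add: N_def)
  qed
qed (auto simp: N_def act_one rel_refl)

lemma N_normal: "normalizes G (carrier G) (N j)"
  unfolding normalizes_def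
proof (intro ballI)
  fix h n assume h: "h \<in> carrier G" and "n \<in> N j"
  then have n: "n \<in> carrier G" "\<And>y. rel j (\<Phi> n y) y" by (auto simp: N_def)
  have "rel j (\<Phi> (h \<otimes> n \<otimes> inv h) y) y" for y
    using rel_act[OF n(2)[of "\<Phi> (inv h) y"] h] h n by (simp add: act_mult act_inv)
  then show "h \<otimes> n \<otimes> inv h \<in> N j" using h n by (simp add: N_def)
qed

lemma N_antimono: "antimono N"
  by (auto simp: antimono_def N_def intro: rel_antimono)

lemma K_subgroup: "subgroup (K l j) G"
proof
  show "g \<otimes> g' \<in> K l j" if "g \<in> K l j" "g' \<in> K l j" for g g'
  proof -
    obtain f where f: "g \<in> carrier G" "f \<in> E" "\<forall>y\<in>U l. f y = y" "\<And>y. rel j (f y) (\<Phi> g y)"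
      using \<open>g \<in> K l j\<close> by (auto simp: K_def)
    obtain f' where f': "g' \<in> carrier G" "f' \<in> E" "\<forall>y\<in>U l. f' y = y" "\<And>y. rel j (f' y) (\<Phi> g' y)"
      using \<open>g' \<in> K l j\<close> by (auto simp: K_def)
    have "rel j (f (f' y)) (\<Phi> (g \<otimes> g') y)" for y
      using rel_trans[OF f(4)[of "f' y"] rel_act[OF f'(4)[of y] f(1)]] f(1) f'(1)
      by (simp add: act_mult)
    then show ?thesis
      using f(1,3) f'(1,3) E_comp[OF f(2) f'(2)] unfolding K_def
      by (auto intro!: bexI[of _ "\<lambda>y. f (f' y)"])
  qed
  show "inv g \<in> K l j" if g: "g \<in> K l j" for g
  proof -
    obtain f where f: "g \<in> carrier G" "f \<in> E" "\<forall>y\<in>U l. f y = y" "\<And>y. rel j (f y) (\<Phi> g y)"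
      using g by (auto simp: K_def)
    obtain h where h: "h \<in> E" "\<And>y. h (f y) = y" "\<And>y. f (h y) = y" using E_inverse[OF f(2)] by blast
    have "rel j (h y) (\<Phi> (inv g) y)" for y
      using rel_sym[OF rel_act[OF f(4)[of "h y"] inv_closed[OF f(1)]]] f(1) by (simp add: act_inv h)
    moreover have "\<forall>y\<in>U l. h y = y" using f(3) h(2) by metis
    ultimately show ?thesis using f(1) h(1) unfolding K_def by auto
  qed
  show "\<one> \<in> K l j" using E_id by (auto simp: K_def act_one rel_refl)
qed (auto simp: K_def)

lemma N_subset_K: "N j \<subseteq> K l j"
proof
  fix g assume "g \<in> N j"
  then have "g \<in> carrier G" "\<forall>y. rel j y (\<Phi> g y)" by (auto simp: N_def dest: rel_sym)
  then show "g \<in> K l j" using E_id unfolding K_def by (auto intro!: bexI[of _ "\<lambda>y. y"])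
qed

lemma K_mono: "mono (\<lambda>l. K l j)"
proof
  fix l l' :: nat assume "l \<le> l'"
  then have "U l' \<subseteq> U l" by (rule U_antimono)
  then show "K l j \<subseteq> K l' j" unfolding K_def by blast
qed

lemma K_antimono: "antimono (K l)"
proof
  fix i j :: nat assume "i \<le> j"
  then have "\<And>y z. rel j y z \<Longrightarrow> rel i y z" by (rule rel_antimono)
  then show "K l j \<subseteq> K l i" unfolding K_def by blast
qed

text \<open>The same Ellis element \<open>f\<close> witnesses both levels. Approximating it more
  finely gives \<open>g'\<close>, which permutes the coarser translates as \<open>g\<close>
  does.\<close>

lemma K_lift:
  assumes "i \<le> j" "g \<in> K l i"
  shows "\<exists>g'\<in>K l j. inv g \<otimes> g' \<in> N i"
proof -
  obtain f where f: "g \<in> carrier G" "f \<in> E" "\<forall>y\<in>U l. f y = y" "\<And>y. rel i (f y) (\<Phi> g y)"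
    using assms by (auto simp: K_def)
  obtain g' where g': "g' \<in> carrier G" "\<And>y. rel j (f y) (\<Phi> g' y)" using E_rel_approx[OF f(2)] by blast
  have "rel i (\<Phi> (inv g \<otimes> g') y) y" for y
  proof -
    have "rel i (\<Phi> g' y) (\<Phi> g y)"
      using rel_trans[OF rel_sym[OF rel_antimono[OF assms(1) g'(2)]] f(4)] .
    from rel_act[OF this inv_closed[OF f(1)]] show ?thesis
      using f(1) g'(1) by (simp add: act_mult act_inv)
  qed
  then have "inv g \<otimes> g' \<in> N i" using f(1) g'(1) by (simp add: N_def)
  moreover have "g' \<in> K l j" using f g' by (auto simp: K_def)
  ultimately show ?thesis by blast
qed

section \<open>Stabilizer indices and the prime spectrum\<close>

lemma stabilizer_subgroup: "subgroup (stabilizer_set G \<Phi> (U j)) G"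
proof
  show "g \<otimes> h \<in> stabilizer_set G \<Phi> (U j)"
    if "g \<in> stabilizer_set G \<Phi> (U j)" "h \<in> stabilizer_set G \<Phi> (U j)" for g h
  proof -
    have "\<Phi> (g \<otimes> h) ` U j = \<Phi> g ` \<Phi> h ` U j"
    proof -
      have "g \<in> carrier G" "h \<in> carrier G" using that by (auto simp: stabilizer_set_def)
      then show ?thesis by (simp add: act_mult image_image)
    qed
    then show ?thesis using that by (auto simp: stabilizer_set_def)
  qed
  show "inv g \<in> stabilizer_set G \<Phi> (U j)" if "g \<in> stabilizer_set G \<Phi> (U j)" for g
  proof -
    have g: "g \<in> carrier G" "\<Phi> g ` U j = U j" using that by (auto simp: stabilizer_set_def)
    have "\<Phi> (inv g) ` U j = \<Phi> (inv g) ` \<Phi> g ` U j" using g by simp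
    also have "\<dots> = U j" using g(1) by (simp add: image_image act_inv)
    finally show ?thesis using g by (simp add: stabilizer_set_def)
  qed
qed (auto simp: stabilizer_set_def act_one)

text \<open>Cosets of the stabilizer correspond to translates of \<open>U j\<close>, and finitely
  many of these disjoint open sets cover the compact space.\<close>

lemma stabilizer_finite_index: "finite (rcosets (stabilizer_set G \<Phi> (U j)))"
proof -
  let ?S = "stabilizer_set G \<Phi> (U j)"
  have cover: "UNIV \<subseteq> (\<Union>g\<in>carrier G. {y. \<Phi> g y \<in> U j})"
    using orbit_meets_open[OF U_open U_nonempty] by blast
  obtain C where C: "C \<subseteq> carrier G" "finite C" "UNIV \<subseteq> (\<Union>g\<in>C. {y. \<Phi> g y \<in> U j})"
    by (rule compactE_image[OF compact_space translates_open cover])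
  have "rcosets ?S \<subseteq> (#>) ?S ` C"
  proof
    fix D assume "D \<in> rcosets ?S"
    then obtain a where a: "a \<in> carrier G" "D = ?S #> a" by (auto simp: RCOSETS_def)
    \<comment> \<open>The point \<open>\<Phi> (inv a) x\<close> marks the translate belonging to
      \<open>?S #> a\<close>; the member of the finite cover that contains it represents the same
      coset.\<close>
    obtain g where g: "g \<in> C" "\<Phi> g (\<Phi> (inv a) x) \<in> U j" using C(3) by blast
    have gc: "g \<in> carrier G" using g C by auto
    have "\<Phi> (g \<otimes> inv a) ` U j = U j"
      by (rule U_invariant[OF _ x_in_U]) (use a g gc in \<open>auto simp: act_mult\<close>)
    then have "g \<otimes> inv a \<in> ?S" using a gc by (simp add: stabilizer_set_def)
    moreover have "g = (g \<otimes> inv a) \<otimes> a" using a gc by (simp add: group_word)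
    ultimately have "g \<in> ?S #> a" unfolding r_coset_def by blast
    from repr_independence[OF this a(1) stabilizer_subgroup] show "D \<in> (#>) ?S ` C"
      using a g by blast
  qed
  then show ?thesis using C(2) finite_surj by blast
qed

lemma prime_dvd_index:
  assumes "Factorial_Ring.prime p" "p dvd card (rcosets (stabilizer_set G \<Phi> (U j)))"
  shows "p \<in> prime_spectrum G \<Phi> U"
proof -
  let ?m = "card (rcosets (stabilizer_set G \<Phi> (U j)))"
  have "rcosets (stabilizer_set G \<Phi> (U j)) \<noteq> {}"
    using one_closed by (auto simp: RCOSETS_def)
  \<comment> \<open>An infinite index would have \<open>card\<close> 0, where
    \<open>multiplicity\<close> is 0 by convention and the prime would go unnoticed.\<close>
  then have "?m \<noteq> 0" using stabilizer_finite_index by simp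
  then have "Factorial_Ring.multiplicity p ?m > 0"
    using assms not_prime_unit by (subst multiplicity_gt_zero_iff) auto
  then have "0 < enat (Factorial_Ring.multiplicity p (group_index G (stabilizer_set G \<Phi> (U j))))"
    by (simp add: group_index_def zero_enat_def)
  also have "\<dots> \<le> steinitz_exponent G \<Phi> U p"
    unfolding steinitz_exponent_def by (rule SUP_upper) simp
  finally show ?thesis using assms(1) by (simp add: prime_spectrum_def)
qed

text \<open>Acting trivially on the translates means lying in every conjugate of the stabilizer. The
  conjugates share one index, so one exponent serves all \<open>y\<close>. The level
  \<open>j\<close> enters through \<open>n\<close> alone.\<close>

lemma pow_mem_N:
  assumes cs: "central_series G H k H" and H: "subgroup H G" and fin: "finite (rcosets H)"
    and spec: "finite (prime_spectrum G \<Phi> U)"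
  defines "P \<equiv> \<Prod>(prime_spectrum G \<Phi> U) * fact (card (rcosets H))"
  shows "\<exists>n. \<forall>h\<in>H. h [^] (P ^ n) \<in> N j"
proof -
  let ?S = "stabilizer_set G \<Phi> (U j)" and ?d = "fact (card (rcosets H)) :: nat"
  let ?m = "card (rcosets ?S)"
  have "rcosets ?S \<noteq> {}" using one_closed by (auto simp: RCOSETS_def)
  then have "?m > 0" using stabilizer_finite_index by (simp add: card_gt_0_iff)
  then obtain n where n: "?m dvd \<Prod>(prime_spectrum G \<Phi> U) ^ n"
    using dvd_power_prod_primes[OF spec] prime_dvd_index by blast
  have "\<Prod>(prime_spectrum G \<Phi> U) ^ n dvd P ^ n"
    unfolding P_def by (intro dvd_power_same) simp
  with n have "?m dvd P ^ n" by (rule dvd_trans)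
  \<comment> \<open>The additional factor \<open>P\<close> absorbs the factorial \<open>?d\<close>
    that appears on intersecting with \<open>H\<close>.\<close>
  then have "?m * ?d dvd P ^ n * P" by (intro mult_dvd_mono) (simp_all add: P_def)
  then have md: "?m * ?d dvd P ^ Suc n" by (simp add: mult.commute)
  have "h [^] (P ^ (Suc n * k)) \<in> N j" if h: "h \<in> H" for h
  proof -
    have hc: "h \<in> carrier G" using h subgroup.mem_carrier[OF H] by blast
    let ?h = "h [^] (P ^ (Suc n * k))"
    have "rel j (\<Phi> ?h y) y" for y
    proof -
      obtain g where g: "g \<in> carrier G" "\<Phi> g y \<in> U j"
        using orbit_meets_open[OF U_open U_nonempty] by blast
      let ?T = "{h \<in> carrier G. g \<otimes> h \<otimes> inv g \<in> ?S}"
      note T = rcosets_conj[OF stabilizer_subgroup g(1), of j]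
      have TH: "subgroup (?T \<inter> H) G" by (rule subgroups_Inter_pair[OF T(1) H])
      have "card (rcosets (?T \<inter> H)) dvd P ^ Suc n"
        using card_rcosets_Int_dvd[OF T(1) H fin] md unfolding T(2) by (rule dvd_trans)
      then have "card (rcosets (?T \<inter> H)) ^ k dvd P ^ (Suc n * k)"
        unfolding power_mult by (rule dvd_power_same)
      then obtain q where q: "P ^ (Suc n * k) = card (rcosets (?T \<inter> H)) ^ k * q" ..
      have "h \<in> (?T \<inter> H) <#> H"
        using set_multI[OF subgroup.one_closed[OF TH] h] hc by simp
      from central_series_pow_mem[OF cs H TH _ this]
      have "h [^] (card (rcosets (?T \<inter> H)) ^ k) \<in> ?T \<inter> H" by simp
      from subgroup_nat_pow_closed[OF TH this, of q] have "?h \<in> ?T \<inter> H"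
        by (simp only: nat_pow_pow[OF hc] q)
      then have "\<Phi> (g \<otimes> ?h \<otimes> inv g) ` U j = U j" by (simp add: stabilizer_set_def)
      then have "\<Phi> (g \<otimes> ?h \<otimes> inv g) (\<Phi> g y) \<in> U j" using g(2) by blast
      then have "\<Phi> g (\<Phi> ?h y) \<in> U j" using g(1) hc by (simp add: act_mult act_inv)
      then show ?thesis using g by (auto simp: rel_def)
    qed
    then show ?thesis using hc by (simp add: N_def)
  qed
  then show ?thesis by blast
qed

text \<open>At a late level \<open>j\<close>, an \<open>f\<close> fixing some \<open>U l\<close>
  permutes the translates of \<open>U j\<close> as some \<open>f'\<close> fixing \<open>U m\<close>
  does. So for \<open>y\<close> in \<open>U m\<close> the points \<open>f y\<close> and
  \<open>y\<close> share a translate of \<open>U j\<close>, and these translates become arbitrarily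
  small.\<close>

lemma pointwise_stabilizers_stabilize:
  assumes "virtually_nilpotent G" "finite (prime_spectrum G \<Phi> U)"
  shows "\<exists>m. \<forall>f\<in>E. \<forall>l. (\<forall>y\<in>U l. f y = y) \<longrightarrow> (\<forall>y\<in>U m. f y = y)"
proof -
  obtain H where H: "finitely_generated_subgroup G H" "nilpotent_subgroup G H" "finite (rcosets H)"
    using assms(1) by (auto simp: virtually_nilpotent_def)
  have sH: "subgroup H G" using H(2) by (simp add: nilpotent_subgroup_def)
  obtain k where k: "central_series G H k H" using central_series_exists[OF H(1,2)] by blast
  let ?P = "\<Prod>(prime_spectrum G \<Phi> U) * fact (card (rcosets H))"
  have "?P > 0"
    using assms(2) by (auto simp: prime_spectrum_def prod_pos prime_gt_0_nat)
  from double_chain_stabilizes[OF k sH H(3) this N_subgroup N_normal N_antimono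
      pow_mem_N[OF k sH H(3) assms(2)] K_subgroup N_subset_K K_mono K_antimono K_lift]
  obtain m J where J: "\<And>j l. J \<le> j \<Longrightarrow> K l j \<subseteq> K m j" by blast
  have "f y = y" if f: "f \<in> E" "\<forall>y\<in>U l. f y = y" and y: "y \<in> U m" for f l y
  proof (rule ccontr)
    assume "f y \<noteq> y"
    then obtain J' where J': "\<And>j y' z. J' \<le> j \<Longrightarrow> rel j y' z \<Longrightarrow> dist y' z < dist (f y) y"
      using dist_of_rel[of "dist (f y) y"] by auto
    define j where "j = max J J'"
    obtain g where g: "g \<in> carrier G" "\<And>z. rel j (f z) (\<Phi> g z)" using E_rel_approx[OF f(1)] by blast
    then have "g \<in> K l j" using f by (auto simp: K_def)
    then have "g \<in> K m j" using J[of j l] by (auto simp: j_def)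
    then obtain f' where f': "\<forall>y\<in>U m. f' y = y" "\<And>z. rel j (f' z) (\<Phi> g z)" by (auto simp: K_def)
    have "rel j (f y) y" using rel_trans[OF g(2)[of y] rel_sym[OF f'(2)[of y]]] f'(1) y by simp
    then show False using J'[of j "f y" y] by (simp add: j_def)
  qed
  then show ?thesis by blast
qed

theorem stable:
  assumes "virtually_nilpotent G" "finite (prime_spectrum G \<Phi> U)"
  shows "stable_action G \<Phi>"
proof -
  obtain m where m: "\<And>f l y. f \<in> E \<Longrightarrow> (\<And>y. y \<in> U l \<Longrightarrow> f y = y) \<Longrightarrow> y \<in> U m \<Longrightarrow> f y = y"
    using pointwise_stabilizers_stabilize[OF assms] by blast
  obtain d where d: "d > 0" "\<And>T. diameter T < d \<Longrightarrow> \<exists>g\<in>carrier G. \<forall>y\<in>T. \<Phi> g y \<in> U m"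
    using rel_Lebesgue[of m] by blast
  have "f1 z = f2 z"
    if W: "diameter W < d" and V: "open V" "V \<noteq> {}" "V \<subseteq> W"
      and f: "f1 \<in> E" "f2 \<in> E" and eq: "\<forall>y\<in>V. f1 y = f2 y" and z: "z \<in> W" for W V f1 f2 z
  proof -
    \<comment> \<open>With \<open>h\<close> the inverse of \<open>f2\<close>, the composite of
      \<open>h\<close> and \<open>f1\<close> is trivial on \<open>V\<close>. Conjugating it by an
      \<open>a\<close> that takes \<open>x\<close> into \<open>V\<close> makes it trivial near
      \<open>x\<close>, hence on some \<open>U l\<close>.\<close>
    obtain h where h: "h \<in> E" "\<And>y. h (f2 y) = y" "\<And>y. f2 (h y) = y" using E_inverse[OF f(2)] by blast
    obtain a where a: "a \<in> carrier G" "\<Phi> a x \<in> V" using orbit_meets_open[OF V(1,2)] by blast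
    obtain b where b: "b \<in> carrier G" "\<And>y. y \<in> W \<Longrightarrow> \<Phi> b y \<in> U m" using d(2)[OF W] by blast
    define f where "f = (\<lambda>y. \<Phi> (inv a) (h (f1 (\<Phi> a y))))"
    have fE: "f \<in> E"
      unfolding f_def
      by (rule E_comp[OF E_act[OF inv_closed[OF a(1)]] E_comp[OF h(1) E_comp[OF f(1) E_act[OF a(1)]]]])
    have "open (\<Phi> a -` V)" using open_vimage[OF V(1) act_continuous[OF a(1)]] .
    moreover have "x \<in> \<Phi> a -` V" using a(2) by simp
    ultimately obtain r where r: "r > 0" "ball x r \<subseteq> \<Phi> a -` V" by (rule openE)
    obtain l where l: "U l \<subseteq> ball x r" using U_small[OF r(1)] by blast
    have "f y = y" if "y \<in> U l" for y
    proof -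
      have "\<Phi> a y \<in> V" using that l r(2) by blast
      then have "f1 (\<Phi> a y) = f2 (\<Phi> a y)" using eq by blast
      then show ?thesis by (simp add: f_def h(2) act_inv(1)[OF a(1)])
    qed
    then have triv: "f y = y" if "y \<in> U m" for y using m[OF fE _ that] by blast
    \<comment> \<open>\<open>W\<close> lies in one translate of \<open>U m\<close>. It contains
      \<open>\<Phi> a x\<close>, so \<open>inv a\<close> carries this translate onto
      \<open>U m\<close>, where the conjugated map is trivial.\<close>
    have "rel m (\<Phi> a x) z" using b a V z by (auto simp: rel_def)
    then have "\<Phi> (inv a) z \<in> U m"
      using rel_mem[of m "\<Phi> a x" z "inv a"] a x_in_U by (simp add: act_inv)
    from triv[OF this] have "\<Phi> (inv a) (h (f1 z)) = \<Phi> (inv a) z" using a by (simp add: f_def act_inv)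
    then have "h (f1 z) = z" using a act_inv(2) by metis
    then show ?thesis using h(3) by metis
  qed
  then have "locally_quasi_analytic E"
    unfolding locally_quasi_analytic_def using d(1) by (intro exI[of _ d]) blast
  then show ?thesis by (simp add: stable_action_def)
qed

end

theorem theorem1p1:
  fixes G :: "('g, 'b) monoid_scheme" and \<Phi> :: "'g \<Rightarrow> 'a::metric_space \<Rightarrow> 'a"
    and x :: 'a and U :: "nat \<Rightarrow> 'a set"
  assumes "nilpotent_cantor_action G \<Phi>"
    and "adapted_basis G \<Phi> x U"
    and "finite (prime_spectrum G \<Phi> U)"
  shows "stable_action G \<Phi>"
proof -
  have c: "cantor_action G \<Phi>" "virtually_nilpotent G"
    using assms(1) by (simp_all add: nilpotent_cantor_action_def)
  then have "group G" by (simp add: cantor_action_def homeo_action_def)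
  then interpret adapted_cantor_action G \<Phi> x U
    using c(1) assms(2) by (simp add: adapted_cantor_action_def adapted_cantor_action_axioms_def)
  show ?thesis by (rule stable[OF c(2) assms(3)])
qed

end
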